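(* Let $k$ be a field of characteristic zero and let $B$ be an affine $k$-domain of dimension two. Then the following are equivalent: (I) $B=k^{[2]}$. (II) $ML^{*}(B)=k$. (III) $ML(B)=k$ and $ML^{*}(B)\neq B$.
   Context: An affine $k$-domain is an integral domain that is a finitely generated (commutative, unital) $k$-algebra; dimension means Krull dimension. For a ring $R$ and an $R$-algebra $A$, the notation $A=R^{[n]}$ means that $A$ is isomorphic, as an $R$-algebra, to a polynomial ring in $n$ variables over $R$. $LND(B)$ denotes the set of locally nilpotent $k$-derivations of $B$, i.e. $k$-derivations $D:B\to B$ such that for every $b\in B$ there is $m\ge 1$ with $D^m(b)=0$. The Makar-Limanov invariant is $ML(B):=\bigcap_{D\in LND(B)}\operatorname{Ker} D$. Let $LND^{*}(B):=\{D\in LND(B)\mid Ds=1 \text{ for some } s\in B\}$. The Makar-Limanov--Freudenburg invariant is $ML^{*}(B):=\bigcap_{D\in LND^{*}(B)}\operatorname{Ker} D$, with the convention $ML^{*}(B):=B$ if $LND^{*}(B)=\emptyset$. *)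

theory Defs
  imports
    "HOL-Algebra.Algebraic_Closure_Type"
    "HOL-Library.Extended_Nat"
begin

text \<open>
  A commutative algebra over a field is a ring type together with a scalar multiplication.
  The class of commutative rings used here has \<open>0 \<noteq> 1\<close>, so the structure map
  \<open>\<lambda>c. scale c 1\<close> is injective.
\<close>

locale comm_algebra = vector_space scale
  for scale :: "'k::field \<Rightarrow> 'b::comm_ring_1 \<Rightarrow> 'b" +
  assumes mult_scale_left: "scale c x * y = scale c (x * y)"

definition subalgebra :: "('k::field \<Rightarrow> 'b::comm_ring_1 \<Rightarrow> 'b) \<Rightarrow> 'b set \<Rightarrow> bool" where
  "subalgebra scale S \<longleftrightarrow>
     module.subspace scale S \<and> 1 \<in> S \<and> (\<forall>x\<in>S. \<forall>y\<in>S. x * y \<in> S)"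

locale affine_domain = comm_algebra scale
  for scale :: "'k::field \<Rightarrow> 'b::idom \<Rightarrow> 'b" +
  assumes finitely_generated: "\<exists>S. finite S \<and> subalgebra scale hull S = UNIV"

text \<open>The copy of the base field inside the algebra.\<close>

definition base_field :: "('k::field \<Rightarrow> 'b::comm_ring_1 \<Rightarrow> 'b) \<Rightarrow> 'b set" where
  "base_field scale = range (\<lambda>c. scale c 1)"

text \<open>
  The supremum of the lengths \<open>n\<close> of strict chains \<open>P 0 \<subset> \<dots> \<subset> P n\<close> of prime ideals.
  (A ring without prime ideals gets dimension 0 here; domains always have one.)
\<close>

definition krull_dim :: "('a, 'm) ring_scheme \<Rightarrow> enat" where
  "krull_dim R = Sup {enat n | n. \<exists>P :: nat \<Rightarrow> 'a set.
     (\<forall>i\<le>n. primeideal (P i) R) \<and> (\<forall>i<n. P i \<subset> P (Suc i))}"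

definition algebra_iso ::
  "('k::field \<Rightarrow> 'a::comm_ring_1 \<Rightarrow> 'a) \<Rightarrow> ('k \<Rightarrow> 'b::comm_ring_1 \<Rightarrow> 'b) \<Rightarrow> ('a \<Rightarrow> 'b) \<Rightarrow> bool"
where
  "algebra_iso s1 s2 f \<longleftrightarrow>
     Vector_Spaces.linear s1 s2 f \<and> f 1 = 1 \<and> (\<forall>x y. f (x * y) = f x * f y) \<and> bij f"

text \<open>
  The polynomial ring in two variables over \<open>'k\<close> is the iterated one, \<open>'k poly poly\<close>,
  with constants \<open>[:[:c:]:]\<close>.
\<close>

definition poly2_scale :: "'k::field \<Rightarrow> 'k poly poly \<Rightarrow> 'k poly poly" where
  "poly2_scale c p = Polynomial.smult [:c:] p"

lemma comm_algebra_poly2: "comm_algebra (poly2_scale :: 'k::field \<Rightarrow> _)"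
  by unfold_locales
    (auto simp: poly2_scale_def smult_add_right smult_add_left[symmetric] one_pCons[symmetric] mult.commute)

definition is_poly_ring2 :: "('k::field \<Rightarrow> 'b::comm_ring_1 \<Rightarrow> 'b) \<Rightarrow> bool" where
  "is_poly_ring2 scale \<longleftrightarrow> (\<exists>f. algebra_iso poly2_scale scale f)"

definition derivation :: "('k::field \<Rightarrow> 'b::comm_ring_1 \<Rightarrow> 'b) \<Rightarrow> ('b \<Rightarrow> 'b) \<Rightarrow> bool" where
  "derivation scale D \<longleftrightarrow>
     Vector_Spaces.linear scale scale D \<and> (\<forall>x y. D (x * y) = D x * y + x * D y)"

definition LND :: "('k::field \<Rightarrow> 'b::comm_ring_1 \<Rightarrow> 'b) \<Rightarrow> ('b \<Rightarrow> 'b) set" where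
  "LND scale = {D. derivation scale D \<and> (\<forall>b. \<exists>m\<ge>1. (D ^^ m) b = 0)}"

definition LND_star :: "('k::field \<Rightarrow> 'b::comm_ring_1 \<Rightarrow> 'b) \<Rightarrow> ('b \<Rightarrow> 'b) set" where
  "LND_star scale = {D \<in> LND scale. \<exists>s. D s = 1}"

definition makar_limanov :: "('k::field \<Rightarrow> 'b::comm_ring_1 \<Rightarrow> 'b) \<Rightarrow> 'b set" where
  "makar_limanov scale = (\<Inter>D\<in>LND scale. {b. D b = 0})"

text \<open>If \<open>LND_star scale\<close> is empty, the intersection below is \<open>UNIV\<close>, i.e. the whole ring.\<close>

definition makar_limanov_freudenburg :: "('k::field \<Rightarrow> 'b::comm_ring_1 \<Rightarrow> 'b) \<Rightarrow> 'b set" where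
  "makar_limanov_freudenburg scale = (\<Inter>D\<in>LND_star scale. {b. D b = 0})"

end

theory Submission
  imports Defs
begin

text \<open>
  Write \<open>k\<close> for the base field. If \<open>B\<close> is \<open>k[x, y]\<close>, then the two partial derivatives have slices, and
  their kernels meet in \<open>k\<close>. If \<open>ML*(B) = k\<close>, then \<open>ML(B)\<close>, which lies between \<open>k\<close> and \<open>ML*(B)\<close>, is \<open>k\<close> as
  well, and \<open>B \<noteq> k\<close> because of the dimension. The substance is the way back to \<open>B = k[x, y]\<close>.

  Assume \<open>ML(B) = k\<close>, and let \<open>D\<close> be locally nilpotent with \<open>D s = 1\<close>. By the slice theorem
  (\<open>slice_expansion\<close>) \<open>B = A[s]\<close> is a polynomial ring over \<open>A = Ker D\<close>. Some locally nilpotent \<open>E\<close> does not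
  vanish on \<open>A\<close>: otherwise \<open>A = ML(B) = k\<close>, and \<open>B = k[s]\<close> has dimension at most one. As \<open>B\<close> is
  finitely generated, \<open>E\<close> raises the degree in \<open>s\<close> by at most some \<open>d\<close>, and for the least such \<open>d\<close> the
  homogeneous component of \<open>E\<close> of degree \<open>d\<close> is a nonzero locally nilpotent derivation \<open>E'\<close>. It maps
  \<open>s\<close> to a multiple of \<open>s\<close>, and local nilpotency forces \<open>E' s = 0\<close>. Hence \<open>E' = s\<^sup>d \<Delta>\<close>, where \<open>\<Delta>\<close> is a
  locally nilpotent derivation that maps \<open>A\<close> to \<open>A\<close>, kills \<open>s\<close> and is nonzero on \<open>A\<close> (\<open>LND_restricting_to_kernel\<close>).

  Put \<open>C = A \<inter> Ker \<Delta>\<close>. If some \<open>f \<in> C\<close> were transcendental over \<open>k\<close>, then \<open>f\<close>, an element \<open>c \<in> A\<close> with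
  \<open>\<Delta> c \<noteq> 0\<close>, and \<open>s\<close> would be algebraically independent, because an element outside the kernel of a
  derivation is transcendental over that kernel. In a finitely generated domain three independent elements
  give a chain of four primes (\<open>transcendence_degree_le_krull_dim\<close>), against dimension two. So \<open>C\<close> is
  algebraic over \<open>k\<close>; every derivation kills algebraic elements, so \<open>C \<subseteq> ML(B) = k\<close>. Now \<open>\<Delta>\<close> has a slice
  \<open>r \<in> A\<close>, because the last nonzero iterate \<open>\<Delta>\<^sup>n c\<close> is a unit of \<open>k\<close>. The slice theorem for \<open>\<Delta>\<close> on \<open>A\<close> gives
  \<open>A = k[r]\<close>, and therefore \<open>B = k[r, s]\<close>.

  The chain of primes needs a form of the Nullstellensatz: a homomorphism from a subring \<open>R\<close> of a domain to
  an algebraically closed field extends to a finitely generated extension of \<open>R\<close> as soon as it does not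
  vanish at one suitable nonzero element of \<open>R\<close> (\<open>extend_hom_finitely_generated\<close>). With it, the last element
  of an independent sequence can be specialised to a constant while the others stay fixed; the kernels of
  the successive specialisations form the chain.
\<close>

section \<open>Subrings, polynomials over subrings and homomorphisms\<close>

definition subring_set :: "'a::comm_ring_1 set \<Rightarrow> bool" where
  "subring_set R \<longleftrightarrow> 1 \<in> R \<and> (\<forall>x\<in>R. \<forall>y\<in>R. x - y \<in> R \<and> x * y \<in> R)"

lemma subring_set_1: "subring_set R \<Longrightarrow> 1 \<in> R"
  and subring_set_diff: "subring_set R \<Longrightarrow> x \<in> R \<Longrightarrow> y \<in> R \<Longrightarrow> x - y \<in> R"
  and subring_set_mult: "subring_set R \<Longrightarrow> x \<in> R \<Longrightarrow> y \<in> R \<Longrightarrow> x * y \<in> R"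
  by (auto simp: subring_set_def)

lemma subring_setI:
  "1 \<in> R \<Longrightarrow> (\<And>x y. x \<in> R \<Longrightarrow> y \<in> R \<Longrightarrow> x - y \<in> R) \<Longrightarrow> (\<And>x y. x \<in> R \<Longrightarrow> y \<in> R \<Longrightarrow> x * y \<in> R)
    \<Longrightarrow> subring_set R"
  by (auto simp: subring_set_def)

lemma subring_set_0: "subring_set R \<Longrightarrow> 0 \<in> R"
  using subring_set_1[of R] subring_set_diff[of R 1 1] by simp

lemma subring_set_uminus: "subring_set R \<Longrightarrow> x \<in> R \<Longrightarrow> - x \<in> R"
  using subring_set_diff[of R 0 x] by (simp add: subring_set_0)

lemma subring_set_add: "subring_set R \<Longrightarrow> x \<in> R \<Longrightarrow> y \<in> R \<Longrightarrow> x + y \<in> R"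
  using subring_set_diff[of R x "- y"] by (simp add: subring_set_uminus)

lemma subring_set_power: "subring_set R \<Longrightarrow> x \<in> R \<Longrightarrow> x ^ n \<in> R"
  by (induction n) (auto intro: subring_set_1 subring_set_mult)

lemma subring_set_sum: "subring_set R \<Longrightarrow> (\<And>i. i \<in> I \<Longrightarrow> f i \<in> R) \<Longrightarrow> sum f I \<in> R"
  by (induction I rule: infinite_finite_induct) (auto intro: subring_set_0 subring_set_add)

lemmas subring_set_closed = subring_set_0 subring_set_1 subring_set_diff subring_set_mult
  subring_set_uminus subring_set_add subring_set_power subring_set_sum

lemma subring_set_hull: "subring_set (subring_set hull G)"
  unfolding hull_def by (auto simp: subring_set_def)

definition polys_over :: "'a::comm_ring_1 set \<Rightarrow> 'a poly set" where
  "polys_over R = {p. \<forall>i. coeff p i \<in> R}"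

lemma subring_set_polys_over:
  assumes "subring_set R"
  shows "subring_set (polys_over R)"
  unfolding subring_set_def polys_over_def
  by (auto simp: coeff_mult intro!: subring_set_closed[OF assms])

lemma pCons_in_polys_over:
  assumes "subring_set R"
  shows "pCons a p \<in> polys_over R \<longleftrightarrow> a \<in> R \<and> p \<in> polys_over R"
  unfolding polys_over_def
  by (auto simp: coeff_pCons split: nat.splits)

lemma monom_in_polys_over: "subring_set R \<Longrightarrow> a \<in> R \<Longrightarrow> monom a n \<in> polys_over R"
  by (auto simp: polys_over_def intro: subring_set_0)

lemma smult_in_polys_over: "subring_set R \<Longrightarrow> a \<in> R \<Longrightarrow> p \<in> polys_over R \<Longrightarrow> smult a p \<in> polys_over R"
  by (auto simp: polys_over_def intro: subring_set_mult)

lemma poly_in_subring_set: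
  assumes "subring_set T" "p \<in> polys_over T" "x \<in> T"
  shows "poly p x \<in> T"
  unfolding poly_altdef using assms by (auto simp: polys_over_def intro!: subring_set_closed)

lemma polys_over_mono: "R \<subseteq> T \<Longrightarrow> polys_over R \<subseteq> polys_over T"
  by (auto simp: polys_over_def)

definition adjoin :: "'a::comm_ring_1 set \<Rightarrow> 'a \<Rightarrow> 'a set" where
  "adjoin R x = (\<lambda>p. poly p x) ` polys_over R"

lemma subring_set_adjoin:
  assumes "subring_set R"
  shows "subring_set (adjoin R x)"
  unfolding subring_set_def
proof (intro conjI ballI)
  note P = subring_set_polys_over[OF assms]
  show "1 \<in> adjoin R x"
    unfolding adjoin_def using subring_set_1[OF P] by (auto intro!: image_eqI[where x = 1])
  fix u v assume "u \<in> adjoin R x" "v \<in> adjoin R x"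
  then obtain p q where "p \<in> polys_over R" "u = poly p x" "q \<in> polys_over R" "v = poly q x"
    by (auto simp: adjoin_def)
  then have "u - v = poly (p - q) x" "u * v = poly (p * q) x" "p - q \<in> polys_over R" "p * q \<in> polys_over R"
    using P by (auto intro: subring_set_diff subring_set_mult)
  then show "u - v \<in> adjoin R x" "u * v \<in> adjoin R x"
    unfolding adjoin_def by blast+
qed

lemma subset_adjoin: "subring_set R \<Longrightarrow> R \<subseteq> adjoin R x"
proof
  fix a assume "subring_set R" "a \<in> R"
  then show "a \<in> adjoin R x"
    unfolding adjoin_def
    by (intro image_eqI[where x = "[:a:]"])
      (auto simp: pCons_in_polys_over subring_set_0 subring_set_polys_over)
qed

lemma self_in_adjoin: "subring_set R \<Longrightarrow> x \<in> adjoin R x"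
  unfolding adjoin_def
  by (intro image_eqI[where x = "[:0, 1:]"])
    (auto simp: pCons_in_polys_over subring_set_0 subring_set_1 subring_set_polys_over)

lemma adjoin_minimal: "subring_set T \<Longrightarrow> R \<subseteq> T \<Longrightarrow> x \<in> T \<Longrightarrow> adjoin R x \<subseteq> T"
  using polys_over_mono[of R T] by (auto simp: adjoin_def intro!: poly_in_subring_set)

lemma adjoin_hull: "adjoin (subring_set hull G) x = subring_set hull (insert x G)"
proof
  show "adjoin (subring_set hull G) x \<subseteq> subring_set hull (insert x G)"
    by (intro adjoin_minimal subring_set_hull hull_mono) (auto intro: hull_inc)
  show "subring_set hull (insert x G) \<subseteq> adjoin (subring_set hull G) x"
    using subset_adjoin[OF subring_set_hull[of G], of x] hull_subset[of G subring_set]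
    by (intro hull_minimal subring_set_adjoin subring_set_hull)
      (auto intro: self_in_adjoin subring_set_hull)
qed

text \<open>
  Homomorphisms live on subsets of a type, so that they can be restricted to a subring and extended
  to a larger one without a change of type.
\<close>

definition hom_on :: "'a::comm_ring_1 set \<Rightarrow> ('a \<Rightarrow> 'b::comm_ring_1) \<Rightarrow> bool" where
  "hom_on R \<phi> \<longleftrightarrow> \<phi> 1 = 1 \<and> (\<forall>x\<in>R. \<forall>y\<in>R. \<phi> (x + y) = \<phi> x + \<phi> y \<and> \<phi> (x * y) = \<phi> x * \<phi> y)"

lemma hom_on_1: "hom_on R \<phi> \<Longrightarrow> \<phi> 1 = 1"
  and hom_on_add: "hom_on R \<phi> \<Longrightarrow> x \<in> R \<Longrightarrow> y \<in> R \<Longrightarrow> \<phi> (x + y) = \<phi> x + \<phi> y"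
  and hom_on_mult: "hom_on R \<phi> \<Longrightarrow> x \<in> R \<Longrightarrow> y \<in> R \<Longrightarrow> \<phi> (x * y) = \<phi> x * \<phi> y"
  by (auto simp: hom_on_def)

lemma hom_on_0: "subring_set R \<Longrightarrow> hom_on R \<phi> \<Longrightarrow> \<phi> 0 = 0"
  using hom_on_add[of R \<phi> 0 0] by (simp add: subring_set_0)

lemma hom_on_diff:
  assumes "subring_set R" "hom_on R \<phi>" "x \<in> R" "y \<in> R"
  shows "\<phi> (x - y) = \<phi> x - \<phi> y"
  using hom_on_add[OF assms(2), of "x - y" y] assms by (simp add: subring_set_diff)

lemma hom_on_sum:
  assumes "subring_set R" "hom_on R \<phi>" "\<And>i. i \<in> I \<Longrightarrow> f i \<in> R"
  shows "\<phi> (sum f I) = (\<Sum>i\<in>I. \<phi> (f i))"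
  using assms(3)
  by (induction I rule: infinite_finite_induct)
    (auto simp: hom_on_0[OF assms(1,2)] hom_on_add[OF assms(2)] subring_set_sum[OF assms(1)])

lemma hom_on_subset: "hom_on T \<phi> \<Longrightarrow> R \<subseteq> T \<Longrightarrow> hom_on R \<phi>"
  unfolding hom_on_def by blast

lemma hom_on_comp: "hom_on T \<phi> \<Longrightarrow> hom_on R \<theta> \<Longrightarrow> \<theta> ` R \<subseteq> T \<Longrightarrow> hom_on R (\<lambda>x. \<phi> (\<theta> x))"
  unfolding hom_on_def by (auto simp: image_subset_iff)

lemma hom_on_image_hull:
  assumes "hom_on (subring_set hull G) \<psi>"
  shows "\<psi> ` (subring_set hull G) = subring_set hull (\<psi> ` G)"
proof
  let ?T = "subring_set hull G"
  note T = subring_set_hull[of G]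
  have "subring_set (\<psi> ` ?T)"
  proof (rule subring_setI)
    show "1 \<in> \<psi> ` ?T"
      using subring_set_1[OF T] hom_on_1[OF assms] by (metis imageI)
    fix x y assume "x \<in> \<psi> ` ?T" "y \<in> \<psi> ` ?T"
    then obtain u v where uv: "u \<in> ?T" "v \<in> ?T" "x = \<psi> u" "y = \<psi> v"
      by blast
    then have "x - y = \<psi> (u - v)" "x * y = \<psi> (u * v)"
      using hom_on_diff[OF T assms] hom_on_mult[OF assms] by auto
    then show "x - y \<in> \<psi> ` ?T" "x * y \<in> \<psi> ` ?T"
      using uv subring_set_diff[OF T] subring_set_mult[OF T] by auto
  qed
  then show "subring_set hull (\<psi> ` G) \<subseteq> \<psi> ` ?T"
    by (intro hull_minimal image_mono hull_subset)
  let ?U = "subring_set hull (\<psi> ` G)"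
  note U = subring_set_hull[of "\<psi> ` G"]
  have "?T \<subseteq> {x \<in> ?T. \<psi> x \<in> ?U}"
  proof (rule hull_minimal)
    show "G \<subseteq> {x \<in> ?T. \<psi> x \<in> ?U}"
      by (auto intro: hull_inc)
    show "subring_set {x \<in> ?T. \<psi> x \<in> ?U}"
      by (rule subring_setI)
        (auto simp: hom_on_1[OF assms] hom_on_diff[OF T assms] hom_on_mult[OF assms]
          subring_set_1[OF T] subring_set_1[OF U] subring_set_diff[OF T] subring_set_diff[OF U]
          subring_set_mult[OF T] subring_set_mult[OF U])
  qed
  then show "\<psi> ` ?T \<subseteq> ?U"
    by auto
qed

lemma hom_on_map_poly:
  assumes "subring_set R" "hom_on R \<phi>"
  shows "hom_on (polys_over R) (map_poly \<phi>)"
  unfolding hom_on_def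
proof (intro conjI ballI)
  note c = coeff_map_poly[of \<phi>, OF hom_on_0[OF assms]]
  show "map_poly \<phi> 1 = 1"
    using hom_on_1[OF assms(2)] by simp
  fix p q assume "p \<in> polys_over R" "q \<in> polys_over R"
  then have "coeff p i \<in> R" "coeff q i \<in> R" for i
    by (auto simp: polys_over_def)
  then show "map_poly \<phi> (p + q) = map_poly \<phi> p + map_poly \<phi> q"
    and "map_poly \<phi> (p * q) = map_poly \<phi> p * map_poly \<phi> q"
    by (auto intro!: poly_eqI sum.cong simp: c coeff_mult hom_on_add[OF assms(2)] subring_set_mult[OF assms(1)]
        hom_on_sum[OF assms] hom_on_mult[OF assms(2)])
qed

lemma hom_on_eval_map_poly:
  assumes "subring_set R" "hom_on R \<phi>"
  shows "hom_on (polys_over R) (\<lambda>p. poly (map_poly \<phi> p) w)"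
  using hom_on_map_poly[OF assms] by (auto simp: hom_on_def)

lemma map_poly_const: "\<phi> 0 = 0 \<Longrightarrow> map_poly \<phi> [:a:] = [:\<phi> a:]"
  by (simp add: map_poly_pCons)

text \<open>
  Sending \<open>b\<close> to \<open>w\<close> is compatible with \<open>\<phi>\<close> as soon as \<open>w\<close> satisfies all polynomial relations
  that \<open>b\<close> satisfies over \<open>R\<close>.
\<close>

lemma extend_hom_to_adjoin:
  assumes R: "subring_set R" and \<phi>: "hom_on R \<phi>"
    and key: "\<And>p. p \<in> polys_over R \<Longrightarrow> poly p b = 0 \<Longrightarrow> poly (map_poly \<phi> p) w = 0"
  obtains \<psi> where "hom_on (adjoin R b) \<psi>" "\<And>x. x \<in> R \<Longrightarrow> \<psi> x = \<phi> x"
    "\<And>p. p \<in> polys_over R \<Longrightarrow> \<psi> (poly p b) = poly (map_poly \<phi> p) w"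
proof -
  define ev where "ev p = poly (map_poly \<phi> p) w" for p
  note P = subring_set_polys_over[OF R]
  have ev: "hom_on (polys_over R) ev"
    unfolding ev_def by (rule hom_on_eval_map_poly[OF R \<phi>])
  define \<psi> where "\<psi> y = ev (SOME p. p \<in> polys_over R \<and> poly p b = y)" for y
  have \<psi>: "\<psi> (poly p b) = ev p" if p: "p \<in> polys_over R" for p
  proof -
    let ?q = "SOME q. q \<in> polys_over R \<and> poly q b = poly p b"
    have q: "?q \<in> polys_over R \<and> poly ?q b = poly p b"
      by (rule someI[where x = p]) (use p in auto)
    then have "ev (?q - p) = 0"
      unfolding ev_def using p by (intro key) (auto intro: subring_set_diff[OF P])
    then show ?thesis
      using hom_on_diff[OF P ev] q p by (simp add: \<psi>_def)
  qed
  show ?thesis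
  proof (rule that[of \<psi>])
    show "\<psi> x = \<phi> x" if "x \<in> R" for x
    proof -
      have "[:x:] \<in> polys_over R"
        using that subring_set_0[OF P] by (simp add: pCons_in_polys_over[OF R])
      from \<psi>[OF this] show ?thesis
        by (simp add: ev_def map_poly_const hom_on_0[OF R \<phi>])
    qed
    show "hom_on (adjoin R b) \<psi>"
      unfolding hom_on_def
    proof (intro conjI ballI)
      show "\<psi> 1 = 1"
        using \<psi>[OF subring_set_1[OF P]] hom_on_1[OF ev] by simp
      fix u v assume "u \<in> adjoin R b" "v \<in> adjoin R b"
      then obtain p q where pq: "p \<in> polys_over R" "u = poly p b" "q \<in> polys_over R" "v = poly q b"
        by (auto simp: adjoin_def)
      then show "\<psi> (u + v) = \<psi> u + \<psi> v" "\<psi> (u * v) = \<psi> u * \<psi> v"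
        using \<psi>[of "p + q"] \<psi>[of "p * q"] \<psi>[of p] \<psi>[of q] P
          hom_on_add[OF ev, of p q] hom_on_mult[OF ev, of p q]
        by (auto simp: subring_set_add subring_set_mult)
    qed
  qed (simp add: \<psi> ev_def)
qed

definition transcendental_over :: "'a::comm_ring_1 set \<Rightarrow> 'a \<Rightarrow> bool" where
  "transcendental_over R x \<longleftrightarrow> (\<forall>p\<in>polys_over R. poly p x = 0 \<longrightarrow> p = 0)"

lemma transcendental_over_antimono:
  "transcendental_over T x \<Longrightarrow> R \<subseteq> T \<Longrightarrow> transcendental_over R x"
  using polys_over_mono[of R T] by (auto simp: transcendental_over_def)

lemma polys_over_image:
  assumes "\<phi> 0 = 0" "0 \<in> R" "p \<in> polys_over (\<phi> ` R)"
  obtains q where "q \<in> polys_over R" "map_poly \<phi> q = p"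
proof -
  define g where "g a = (if a = 0 then 0 else (SOME x. x \<in> R \<and> \<phi> x = a))" for a
  have g: "g a \<in> R \<and> \<phi> (g a) = a" if a: "a \<in> \<phi> ` R" for a
  proof (cases "a = 0")
    case True
    then show ?thesis using assms by (simp add: g_def)
  next
    case False
    obtain x where "x \<in> R \<and> \<phi> x = a"
      using a by blast
    then have "(SOME x. x \<in> R \<and> \<phi> x = a) \<in> R \<and> \<phi> (SOME x. x \<in> R \<and> \<phi> x = a) = a"
      by (rule someI)
    with False show ?thesis by (simp add: g_def)
  qed
  have "g 0 = 0"
    by (simp add: g_def)
  note coeff = coeff_map_poly[of g, OF this] coeff_map_poly[of \<phi>, OF assms(1)]
  have "coeff p i \<in> \<phi> ` R" for i
    using assms(3) by (simp add: polys_over_def)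
  then have "map_poly g p \<in> polys_over R" "map_poly \<phi> (map_poly g p) = p"
    using g by (auto simp: polys_over_def coeff intro: poly_eqI)
  then show ?thesis
    using that by blast
qed

lemma transcendental_over_image:
  fixes \<iota> :: "'b::comm_ring_1 \<Rightarrow> 'a::comm_ring_1"
  assumes R: "subring_set R" and \<iota>: "hom_on UNIV \<iota>" "inj \<iota>" and x: "transcendental_over R x"
  shows "transcendental_over (\<iota> ` R) (\<iota> x)"
  unfolding transcendental_over_def
proof (intro ballI impI)
  have U: "subring_set (UNIV :: 'b set)"
    by (simp add: subring_set_def)
  note i0 = hom_on_0[OF U \<iota>(1)]
  fix p assume p: "p \<in> polys_over (\<iota> ` R)" "poly p (\<iota> x) = 0"
  obtain q where q: "q \<in> polys_over R" "map_poly \<iota> q = p"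
    using polys_over_image[of \<iota>, OF i0 subring_set_0[OF R] p(1)] .
  have "poly (map_poly \<iota> q) (\<iota> x) = \<iota> (poly q x)"
    by (induction q) (simp_all add: i0 map_poly_pCons hom_on_add[OF \<iota>(1)] hom_on_mult[OF \<iota>(1)])
  then have "\<iota> (poly q x) = \<iota> 0"
    using p q i0 by simp
  then have "poly q x = 0"
    using \<iota>(2) by (simp add: inj_eq)
  then show "p = 0"
    using x q by (auto simp: transcendental_over_def)
qed

section \<open>Extending homomorphisms into algebraically closed fields\<close>

lemma degree_cancel_lead:
  fixes f w :: "'a::comm_ring_1 poly"
  assumes "degree w \<le> degree f" "0 < degree f"
  shows "degree (smult (lead_coeff w) f - monom (lead_coeff f) (degree f - degree w) * w) < degree f"
    (is "degree ?g < _")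
proof -
  have "degree ?g \<le> degree f"
    using assms degree_mult_le[of "monom (lead_coeff f) (degree f - degree w)" w]
      degree_monom_le[of "lead_coeff f" "degree f - degree w"]
    by (intro degree_diff_le) (auto intro: order.trans[OF degree_smult_le])
  moreover have "coeff ?g (degree f) = 0"
    using assms(1) by (simp add: coeff_monom_mult)
  ultimately show ?thesis
    using assms(2) by (metis degree_0 leading_coeff_0_iff order_le_less)
qed

text \<open>
  Pseudo-division keeps all coefficients in \<open>R\<close>: instead of dividing by the leading coefficient of the divisor,
  one multiplies the dividend by a power of it.
\<close>

lemma pseudo_division_over:
  fixes w :: "'a::idom poly"
  assumes R: "subring_set R" and w: "w \<in> polys_over R" "w \<noteq> 0" and f: "f \<in> polys_over R"
  obtains N q r where "q \<in> polys_over R" "r \<in> polys_over R"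
    "smult (lead_coeff w ^ N) f = w * q + r" "r = 0 \<or> degree r < degree w"
proof -
  note P = subring_set_polys_over[OF R]
  have "\<exists>N q r. q \<in> polys_over R \<and> r \<in> polys_over R \<and>
     smult (lead_coeff w ^ N) f = w * q + r \<and> (r = 0 \<or> degree r < degree w)"
    using f
  proof (induction "degree f" arbitrary: f rule: less_induct)
    case less
    let ?l = "lead_coeff w" and ?m = "monom (lead_coeff f) (degree f - degree w)"
    let ?g = "smult ?l f - ?m * w"
    have mem: "?l \<in> R" "?m \<in> polys_over R" 
      using w less.prems by (auto simp: polys_over_def intro: monom_in_polys_over subring_set_0[OF R])
    consider "degree f < degree w" | "degree w = 0" | "degree w \<le> degree f" "0 < degree f"
      by linarith
    then show ?case
    proof cases
      case 1
      then show ?thesis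
        using less.prems subring_set_0[OF P] by (intro exI[of _ 0] exI[of _ f]) auto
    next
      case 2
      then obtain c where c: "w = [:c:]"
        by (metis degree_eq_zeroE)
      then show ?thesis
        using less.prems subring_set_0[OF P] by (intro exI[of _ 1] exI[of _ f] exI[of _ 0]) auto
    next
      case 3
      have g: "?g \<in> polys_over R"
        using mem w less.prems by (auto intro!: subring_set_diff[OF P] subring_set_mult[OF P] smult_in_polys_over[OF R])
      from less.hyps[OF degree_cancel_lead[OF 3] g] obtain N q r where IH:
        "q \<in> polys_over R" "r \<in> polys_over R" "smult (?l ^ N) ?g = w * q + r" "r = 0 \<or> degree r < degree w"
        by blast
      have "smult (?l ^ Suc N) f = smult (?l ^ N) ?g + smult (?l ^ N) (?m * w)"
        by (simp add: smult_diff_right mult.commute)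
      also have "\<dots> = w * q + r + smult (?l ^ N) (?m * w)"
        by (simp only: IH(3))
      also have "\<dots> = w * (q + smult (?l ^ N) ?m) + r"
        by (simp add: algebra_simps)
      finally have "smult (?l ^ Suc N) f = w * (q + smult (?l ^ N) ?m) + r" .
      moreover have "q + smult (?l ^ N) ?m \<in> polys_over R"
        using mem IH by (auto intro!: subring_set_add[OF P] smult_in_polys_over[OF R] subring_set_power[OF R])
      ultimately show ?thesis
        using IH by blast
    qed
  qed
  then show ?thesis
    using that by blast
qed

text \<open>
  If \<open>b\<close> is algebraic over \<open>R\<close>, then \<open>R[b]\<close> becomes a field after inverting \<open>R - {0}\<close>, so every nonzero element
  divides a nonzero element of \<open>R\<close>. The proof is a Euclidean algorithm: among all nonzero multiples \<open>w(b)\<close> of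
  \<open>\<beta>\<close>, take \<open>w\<close> of least degree; dividing the minimal relation \<open>h\<close> of \<open>b\<close> by \<open>w\<close> shows that \<open>w\<close> is constant.
\<close>

lemma algebraic_multiple_in_base:
  fixes b :: "'a::idom"
  assumes R: "subring_set R" and b: "\<not> transcendental_over R b"
    and \<beta>: "\<beta> \<in> adjoin R b" "\<beta> \<noteq> 0"
  obtains \<gamma> where "\<gamma> \<in> adjoin R b" "\<beta> * \<gamma> \<in> R" "\<beta> * \<gamma> \<noteq> 0"
proof -
  note P = subring_set_polys_over[OF R] and A = subring_set_adjoin[OF R, of b]
  let ?H = "\<lambda>h. h \<in> polys_over R \<and> h \<noteq> 0 \<and> poly h b = 0"
  obtain h where h: "?H h" "\<And>g. ?H g \<Longrightarrow> degree h \<le> degree g"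
    using b ex_has_least_nat[of ?H _ degree] unfolding transcendental_over_def by blast
  let ?W = "\<lambda>w. w \<in> polys_over R \<and> poly w b \<noteq> 0 \<and> (\<exists>\<gamma>\<in>adjoin R b. poly w b = \<beta> * \<gamma>)"
  obtain v where "v \<in> polys_over R" "\<beta> = poly v b"
    using \<beta> by (auto simp: adjoin_def)
  then have "?W v"
    using \<beta> subring_set_1[OF A] by (intro conjI bexI[where x = 1]) auto
  then obtain w where w: "?W w" "\<And>v. ?W v \<Longrightarrow> degree w \<le> degree v"
    using ex_has_least_nat[of ?W v degree] by blast
  obtain \<gamma> where \<gamma>: "\<gamma> \<in> adjoin R b" "poly w b = \<beta> * \<gamma>"
    using w(1) by blast
  have mem: "w \<in> polys_over R" "w \<noteq> 0" "h \<in> polys_over R" "h \<noteq> 0"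
    using w(1) h(1) by auto
  have wh: "degree w < degree h"
  proof -
    obtain N q r where qr: "q \<in> polys_over R" "r \<in> polys_over R"
      "smult (lead_coeff h ^ N) w = h * q + r" "r = 0 \<or> degree r < degree h"
      using pseudo_division_over[OF R mem(3,4,1)] .
    \<comment> \<open>Reducing \<open>w\<close> modulo \<open>h\<close> only multiplies the value at \<open>b\<close> by a nonzero constant of \<open>R\<close>.\<close>
    let ?c = "lead_coeff h ^ N"
    have r: "poly r b = ?c * poly w b"
      using arg_cong[OF qr(3), of "\<lambda>p. poly p b"] h(1) by simp
    have "?c \<in> R"
      using h(1) by (auto simp: polys_over_def intro: subring_set_power[OF R])
    then have "?c * \<gamma> \<in> adjoin R b"
      using \<gamma>(1) subset_adjoin[OF R, of b] by (auto intro: subring_set_mult[OF A])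
    then have W: "?W r"
      using r \<gamma>(2) w(1) h(1) qr(2) by (intro conjI bexI[where x = "?c * \<gamma>"]) auto
    then have "degree w \<le> degree r"
      by (rule w(2))
    then show ?thesis
      using W qr(4) by auto
  qed
  have "degree w = 0"
  proof (rule ccontr)
    assume w0: "degree w \<noteq> 0"
    obtain N q r where qr: "q \<in> polys_over R" "r \<in> polys_over R"
      "smult (lead_coeff w ^ N) h = w * q + r" "r = 0 \<or> degree r < degree w"
      using pseudo_division_over[OF R mem(1,2,3)] .
    have wq: "poly r b = - (poly w b * poly q b)"
      using arg_cong[OF qr(3), of "\<lambda>p. poly p b"] h(1) by (simp add: eq_neg_iff_add_eq_0 add.commute)
    \<comment> \<open>The value \<open>r(b)\<close> is a multiple of \<open>\<beta>\<close> of smaller degree than \<open>w(b)\<close>, so it vanishes.\<close>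
    have r0: "poly r b = 0"
    proof (rule ccontr)
      assume "poly r b \<noteq> 0"
      moreover have "- (\<gamma> * poly q b) \<in> adjoin R b"
        using \<gamma>(1) qr(1)
        by (intro subring_set_closed[OF A]) (auto simp: adjoin_def)
      ultimately have "?W r"
        using qr(2) wq \<gamma>(2) by (intro conjI bexI[where x = "- (\<gamma> * poly q b)"]) auto
      then have "degree w \<le> degree r"
        by (rule w(2))
      then show False
        using qr(4) \<open>poly r b \<noteq> 0\<close> by auto
    qed
    then have q0: "poly q b = 0"
      using wq w(1) by simp
    have lw: "lead_coeff w ^ N \<noteq> 0"
      using w(1) by auto
    then have dh: "degree (w * q + r) = degree h"
      using qr(3) by (metis degree_smult_eq)
    show False
    proof (cases "q = 0")
      case True
      then have "degree r = degree h" "r \<noteq> 0"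
        using dh qr(3) lw h(1) by auto
      then show False
        using qr(4) wh by simp
    next
      case False
      then have "degree (w * q) = degree w + degree q"
        using mem(2) by (simp add: degree_mult_eq)
      then have "degree (w * q + r) = degree w + degree q"
        using qr(4) by (cases "r = 0") (simp_all add: degree_add_eq_left)
      moreover have "degree h \<le> degree q"
        using False q0 qr(1) h(2) by blast
      ultimately show False
        using dh w0 by simp
    qed
  qed
  then obtain c where "w = [:c:]"
    by (metis degree_eq_zeroE)
  then show ?thesis
    using w(1) that by (auto simp: pCons_in_polys_over[OF R])
qed

lemma alg_closed_infinite: "infinite (UNIV :: 'c::alg_closed_field set)"
proof
  assume fin: "finite (UNIV :: 'c set)"
  define q :: "'c poly" where "q = (\<Prod>a\<in>UNIV. [:- a, 1:])"
  have "poly q a = 0" for a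
    unfolding q_def poly_prod using fin by (intro prod_zero) auto
  moreover have "degree q = card (UNIV :: 'c set)"
    unfolding q_def by (subst degree_prod_eq_sum_degree) auto
  then have "degree (q + 1) > 0"
    using fin by (subst degree_add_eq_left) (auto simp: finite_UNIV_card_ge_0)
  ultimately show False
    using alg_closed_imp_poly_has_root[of "q + 1"] by auto
qed

text \<open>
  For transcendental \<open>b\<close> any value of \<open>b\<close> is allowed; it has to avoid the finitely many roots of the
  polynomial that represents \<open>\<beta>\<close>, and the leading coefficient of that polynomial serves as \<open>\<alpha>\<close>. For algebraic \<open>b\<close> the
  value has to be a root \<open>w\<close> of the image of the minimal relation \<open>h\<close>. Then \<open>\<alpha>\<close> is the leading coefficient of
  \<open>h\<close>, which keeps the degree of the image positive and makes reduction modulo \<open>h\<close> harmless, times a nonzero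
  multiple of \<open>\<beta>\<close> in \<open>R\<close>, which keeps \<open>\<beta>\<close> from being mapped to zero.

  The condition \<open>\<psi> \<beta> \<noteq> 0\<close> is what makes the step iterate: the \<open>\<alpha>\<close> of one step is the \<open>\<beta>\<close> of the next one.
\<close>

lemma extend_hom_one_step:
  fixes b :: "'a::idom"
  assumes R: "subring_set R" and \<beta>: "\<beta> \<in> adjoin R b" "\<beta> \<noteq> 0"
  shows "\<exists>\<alpha>\<in>R. \<alpha> \<noteq> 0 \<and> (\<forall>\<phi> :: 'a \<Rightarrow> 'c::alg_closed_field. hom_on R \<phi> \<longrightarrow> \<phi> \<alpha> \<noteq> 0 \<longrightarrow>
    (\<exists>\<psi>. hom_on (adjoin R b) \<psi> \<and> (\<forall>x\<in>R. \<psi> x = \<phi> x) \<and> \<psi> \<beta> \<noteq> 0))"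
proof (cases "transcendental_over R b")
  case True
  obtain v where v: "v \<in> polys_over R" "\<beta> = poly v b"
    using \<beta> by (auto simp: adjoin_def)
  show ?thesis
  proof (intro bexI conjI allI impI)
    show "lead_coeff v \<in> R" "lead_coeff v \<noteq> 0"
      using v \<beta> by (auto simp: polys_over_def)
    fix \<phi> :: "'a \<Rightarrow> 'c" assume \<phi>: "hom_on R \<phi>" "\<phi> (lead_coeff v) \<noteq> 0"
    then have "coeff (map_poly \<phi> v) (degree v) \<noteq> 0"
      by (simp add: coeff_map_poly hom_on_0[OF R])
    then have "finite {w. poly (map_poly \<phi> v) w = 0}"
      by (intro poly_roots_finite) auto
    then obtain w where w: "poly (map_poly \<phi> v) w \<noteq> 0"
      using alg_closed_infinite ex_new_if_finite by blast
    have key: "poly (map_poly \<phi> p) w = 0" if "p \<in> polys_over R" "poly p b = 0" for p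
      using True that by (auto simp: transcendental_over_def)
    obtain \<psi> where "hom_on (adjoin R b) \<psi>" "\<And>x. x \<in> R \<Longrightarrow> \<psi> x = \<phi> x"
      "\<And>p. p \<in> polys_over R \<Longrightarrow> \<psi> (poly p b) = poly (map_poly \<phi> p) w"
      using extend_hom_to_adjoin[OF R \<phi>(1) key] by blast
    then show "\<exists>\<psi>. hom_on (adjoin R b) \<psi> \<and> (\<forall>x\<in>R. \<psi> x = \<phi> x) \<and> \<psi> \<beta> \<noteq> 0"
      using v w by (intro exI[of _ \<psi>]) auto
  qed
next
  case False
  note P = subring_set_polys_over[OF R]
  let ?H = "\<lambda>h. h \<in> polys_over R \<and> h \<noteq> 0 \<and> poly h b = 0"
  obtain h where h: "?H h" "\<And>g. ?H g \<Longrightarrow> degree h \<le> degree g"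
    using False ex_has_least_nat[of ?H _ degree] unfolding transcendental_over_def by blast
  have deg_h: "degree h > 0"
  proof (rule ccontr)
    assume "\<not> degree h > 0"
    then obtain c where "h = [:c:]"
      by (metis degree_eq_zeroE gr0I)
    then show False
      using h(1) by auto
  qed
  obtain \<gamma> where \<gamma>: "\<gamma> \<in> adjoin R b" "\<beta> * \<gamma> \<in> R" "\<beta> * \<gamma> \<noteq> 0"
    using algebraic_multiple_in_base[OF R False \<beta>] .
  define \<alpha> where "\<alpha> = lead_coeff h * (\<beta> * \<gamma>)"
  have lh: "lead_coeff h \<in> R" "lead_coeff h \<noteq> 0"
    using h(1) by (auto simp: polys_over_def)
  show ?thesis
  proof (intro bexI conjI allI impI)
    show "\<alpha> \<in> R" "\<alpha> \<noteq> 0"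
      unfolding \<alpha>_def using \<gamma> lh by (auto intro!: subring_set_mult[OF R])
    fix \<phi> :: "'a \<Rightarrow> 'c" assume \<phi>: "hom_on R \<phi>" "\<phi> \<alpha> \<noteq> 0"
    then have nz: "\<phi> (lead_coeff h) \<noteq> 0" "\<phi> (\<beta> * \<gamma>) \<noteq> 0"
      unfolding \<alpha>_def using hom_on_mult[OF \<phi>(1) lh(1) \<gamma>(2)] by auto
    have "degree (map_poly \<phi> h) > 0"
      using deg_h nz by (simp add: map_poly_degree_eq)
    then obtain w where w: "poly (map_poly \<phi> h) w = 0"
      using alg_closed_imp_poly_has_root by blast
    define ev where "ev p = poly (map_poly \<phi> p) w" for p
    have ev: "hom_on (polys_over R) ev"
      unfolding ev_def by (rule hom_on_eval_map_poly[OF R \<phi>(1)])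
    have ev_const: "ev [:c:] = \<phi> c" for c
      by (simp add: ev_def map_poly_const hom_on_0[OF R \<phi>(1)])
    \<comment> \<open>All relations of \<open>b\<close> hold for \<open>w\<close>: cancelling leading terms against \<open>h\<close> lowers the degree until the
      minimality of \<open>h\<close> leaves only the zero polynomial.\<close>
    have key: "ev p = 0" if "p \<in> polys_over R" "poly p b = 0" for p
      using that
    proof (induction "degree p" arbitrary: p rule: less_induct)
      case less
      show ?case
      proof (cases "p = 0")
        case True
        then show ?thesis by (simp add: ev_def)
      next
        case False
        then have d: "degree h \<le> degree p" "0 < degree p"
          using h(2)[of p] less.prems deg_h by auto
        let ?m = "monom (lead_coeff p) (degree p - degree h)"
        let ?g = "smult (lead_coeff h) p - ?m * h"
        have mem: "?m \<in> polys_over R" "[:lead_coeff h:] \<in> polys_over R"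
          using less.prems lh subring_set_0[OF P]
          by (auto simp: pCons_in_polys_over[OF R]) (auto simp: polys_over_def intro: subring_set_0[OF R])
        have mem2: "?m * h \<in> polys_over R" "[:lead_coeff h:] * p \<in> polys_over R"
          using mem h(1) less.prems subring_set_mult[OF P] by blast+
        have g: "?g = [:lead_coeff h:] * p - ?m * h"
          by simp
        have "ev ?g = 0"
        proof (rule less.hyps)
          show "degree ?g < degree p"
            by (rule degree_cancel_lead[OF d])
          show "?g \<in> polys_over R"
            unfolding g by (rule subring_set_diff[OF P mem2(2,1)])
          show "poly ?g b = 0"
            using h(1) less.prems by simp
        qed
        then have "ev ([:lead_coeff h:] * p) = ev (?m * h)"
          unfolding g using hom_on_diff[OF P ev mem2(2,1)] by simp
        also have "\<dots> = 0"
          using hom_on_mult[OF ev mem(1), of h] h(1) w by (simp add: ev_def)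
        finally have "\<phi> (lead_coeff h) * ev p = 0"
          using hom_on_mult[OF ev mem(2) less.prems(1)] by (simp only: ev_const)
        then show ?thesis
          using nz by simp
      qed
    qed
    obtain \<psi> where \<psi>: "hom_on (adjoin R b) \<psi>" "\<And>x. x \<in> R \<Longrightarrow> \<psi> x = \<phi> x"
      using extend_hom_to_adjoin[OF R \<phi>(1) key[unfolded ev_def]] by blast
    have "\<psi> \<beta> * \<psi> \<gamma> \<noteq> 0"
      using hom_on_mult[OF \<psi>(1) \<beta>(1) \<gamma>(1)] \<psi>(2)[OF \<gamma>(2)] nz by simp
    then show "\<exists>\<psi>. hom_on (adjoin R b) \<psi> \<and> (\<forall>x\<in>R. \<psi> x = \<phi> x) \<and> \<psi> \<beta> \<noteq> 0"
      using \<psi> by auto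
  qed
qed

lemma extend_hom_finitely_generated:
  fixes R S :: "'a::idom set"
  assumes S: "finite S" and R: "subring_set R" and \<beta>: "\<beta> \<in> subring_set hull (S \<union> R)" "\<beta> \<noteq> 0"
  shows "\<exists>\<alpha>\<in>R. \<alpha> \<noteq> 0 \<and> (\<forall>\<phi> :: 'a \<Rightarrow> 'c::alg_closed_field. hom_on R \<phi> \<longrightarrow> \<phi> \<alpha> \<noteq> 0 \<longrightarrow>
    (\<exists>\<psi>. hom_on (subring_set hull (S \<union> R)) \<psi> \<and> (\<forall>x\<in>R. \<psi> x = \<phi> x) \<and> \<psi> \<beta> \<noteq> 0))"
  using S \<beta>
proof (induction S arbitrary: \<beta> rule: finite_induct)
  case empty
  then show ?case
    using hull_same[of subring_set R, OF R] by (intro bexI[where x = \<beta>]) auto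
next
  case (insert b S)
  let ?T = "subring_set hull (S \<union> R)"
  have eq: "subring_set hull (insert b S \<union> R) = adjoin ?T b"
    by (simp add: adjoin_hull)
  have "R \<subseteq> ?T"
    by (auto intro: hull_inc)
  have "\<beta> \<in> adjoin ?T b"
    using insert.prems(1) by (simp only: eq)
  from extend_hom_one_step[OF subring_set_hull this insert.prems(2), where ?'c = 'c]
  obtain \<beta>' where \<beta>': "\<beta>' \<in> ?T" "\<beta>' \<noteq> 0"
    "\<And>\<phi> :: 'a \<Rightarrow> 'c. hom_on ?T \<phi> \<Longrightarrow> \<phi> \<beta>' \<noteq> 0 \<Longrightarrow>
      \<exists>\<psi>. hom_on (adjoin ?T b) \<psi> \<and> (\<forall>x\<in>?T. \<psi> x = \<phi> x) \<and> \<psi> \<beta> \<noteq> 0"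
    by blast
  from insert.IH[OF \<beta>'(1,2)] obtain \<alpha> where \<alpha>: "\<alpha> \<in> R" "\<alpha> \<noteq> 0"
    "\<And>\<phi> :: 'a \<Rightarrow> 'c. hom_on R \<phi> \<Longrightarrow> \<phi> \<alpha> \<noteq> 0 \<Longrightarrow>
      \<exists>\<psi>. hom_on ?T \<psi> \<and> (\<forall>x\<in>R. \<psi> x = \<phi> x) \<and> \<psi> \<beta>' \<noteq> 0"
    by blast
  show ?case
    unfolding eq
  proof (intro bexI[OF _ \<alpha>(1)] conjI \<alpha>(2) allI impI)
    fix \<phi> :: "'a \<Rightarrow> 'c" assume "hom_on R \<phi>" "\<phi> \<alpha> \<noteq> 0"
    then obtain \<psi> where \<psi>: "hom_on ?T \<psi>" "\<forall>x\<in>R. \<psi> x = \<phi> x" "\<psi> \<beta>' \<noteq> 0"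
      using \<alpha>(3) by blast
    from \<beta>'(3)[OF \<psi>(1,3)] obtain \<chi> where "hom_on (adjoin ?T b) \<chi>" "\<forall>x\<in>?T. \<chi> x = \<psi> x" "\<chi> \<beta> \<noteq> 0"
      by blast
    then show "\<exists>\<psi>. hom_on (adjoin ?T b) \<psi> \<and> (\<forall>x\<in>R. \<psi> x = \<phi> x) \<and> \<psi> \<beta> \<noteq> 0"
      using \<psi>(2) \<open>R \<subseteq> ?T\<close> by (intro exI[of _ \<chi>]) (auto simp: subset_iff)
  qed
qed

section \<open>Chains of prime ideals from algebraically independent elements\<close>

text \<open>
  On \<open>F[x]\<close> one may send \<open>x\<close> to any constant \<open>c\<close> and fix \<open>F\<close>. This extends to the whole algebra unless \<open>c\<close> is a
  root of one particular nonzero polynomial, and \<open>K\<close> is infinite.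
\<close>

lemma specialise_transcendental:
  fixes K F S :: "'a::alg_closed_field set"
  assumes K: "infinite K" and S: "finite S"
    and F: "subring_set F" "K \<subseteq> F" "F \<subseteq> subring_set hull (S \<union> K)"
    and x: "x \<in> subring_set hull (S \<union> K)" "transcendental_over F x"
  obtains \<psi> c where "hom_on (subring_set hull (S \<union> K)) \<psi>" "\<And>y. y \<in> F \<Longrightarrow> \<psi> y = y"
    "c \<in> K" "\<psi> x = c"
proof -
  let ?T = "subring_set hull (S \<union> K)" and ?R = "adjoin F x"
  note R = subring_set_adjoin[OF F(1), of x]
  have "?R \<subseteq> ?T"
    using F x by (intro adjoin_minimal subring_set_hull)
  then have T: "subring_set hull (S \<union> ?R) = ?T"
    using F(2) subset_adjoin[OF F(1), of x] hull_subset[of "S \<union> K" subring_set]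
    by (intro antisym hull_minimal[of _ ?T] hull_mono subring_set_hull) auto
  have one: "1 \<in> subring_set hull (S \<union> ?R)"
    by (intro subring_set_1 subring_set_hull)
  \<comment> \<open>Only the existence of an extension matters here, so \<open>\<beta> = 1\<close>.\<close>
  from extend_hom_finitely_generated[OF S R one one_neq_zero, where ?'c = 'a] obtain \<alpha>
    where \<alpha>: "\<alpha> \<in> ?R" "\<alpha> \<noteq> 0"
      "\<And>\<phi> :: 'a \<Rightarrow> 'a. hom_on ?R \<phi> \<Longrightarrow> \<phi> \<alpha> \<noteq> 0 \<Longrightarrow> \<exists>\<psi>. hom_on ?T \<psi> \<and> (\<forall>x\<in>?R. \<psi> x = \<phi> x)"
    unfolding T by blast
  then obtain v where v: "v \<in> polys_over F" "\<alpha> = poly v x"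
    by (auto simp: adjoin_def)
  with \<alpha>(2) have "v \<noteq> 0"
    by auto
  have "\<not> K \<subseteq> {c. poly v c = 0}"
    using poly_roots_finite[OF \<open>v \<noteq> 0\<close>] K finite_subset by blast
  then obtain c where c: "c \<in> K" "poly v c \<noteq> 0"
    by auto
  have id: "hom_on F (\<lambda>y. y)"
    by (simp add: hom_on_def)
  have key: "poly (map_poly (\<lambda>y. y) p) c = 0" if "p \<in> polys_over F" "poly p x = 0" for p
    using x(2) that by (auto simp: transcendental_over_def)
  obtain \<phi> where \<phi>: "hom_on ?R \<phi>" "\<And>y. y \<in> F \<Longrightarrow> \<phi> y = y"
    "\<And>p. p \<in> polys_over F \<Longrightarrow> \<phi> (poly p x) = poly (map_poly (\<lambda>y. y) p) c"
    using extend_hom_to_adjoin[OF F(1) id key] by blast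
  then have "\<phi> \<alpha> \<noteq> 0"
    using v c by simp
  with \<alpha>(3)[OF \<phi>(1)] obtain \<psi> where \<psi>: "hom_on ?T \<psi>" "\<And>x. x \<in> ?R \<Longrightarrow> \<psi> x = \<phi> x"
    by blast
  have "[:0, 1:] \<in> polys_over F"
    using F(1) by (simp add: pCons_in_polys_over subring_set_0 subring_set_1 subring_set_polys_over)
  then have "\<phi> x = c"
    using \<phi>(3)[of "[:0, 1:]"] by simp
  then have "\<psi> x = c"
    using \<psi>(2)[OF self_in_adjoin[OF F(1)]] by simp
  moreover have "\<psi> y = y" if "y \<in> F" for y
    using \<psi>(2) \<phi>(2) subset_adjoin[OF F(1), of x] that by auto
  ultimately show ?thesis
    using that \<psi>(1) c(1) by blast
qed

lemma primeideal_kernel: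
  fixes \<theta> :: "'b::comm_ring_1 \<Rightarrow> 'c::idom"
  assumes "hom_on UNIV \<theta>"
  shows "primeideal {b. \<theta> b = 0} (ring_of_type_algebra :: 'b ring)"
proof (rule primeidealI)
  have U: "subring_set (UNIV :: 'b set)"
    by (simp add: subring_set_def)
  let ?R = "ring_of_type_algebra :: 'b ring"
  interpret R: cring ?R
    by (rule cring_from_type_algebra)
  note simps = ring_of_type_algebra_def hom_on_0[OF U assms] hom_on_add[OF assms] hom_on_mult[OF assms]
  show "cring ?R"
    by (rule cring_from_type_algebra)
  have neg: "\<ominus>\<^bsub>?R\<^esub> x = - x" for x
    by (rule R.minus_equality) (auto simp: ring_of_type_algebra_def)
  show "ideal {b. \<theta> b = 0} ?R"
  proof (rule idealI)
    show "Ring.ring ?R"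
      by (rule ring_from_type_algebra)
    show "subgroup {b. \<theta> b = 0} (add_monoid ?R)"
    proof (rule R.add.subgroupI)
      fix a assume "a \<in> {b. \<theta> b = 0}"
      then show "\<ominus>\<^bsub>?R\<^esub> a \<in> {b. \<theta> b = 0}"
        using hom_on_diff[OF U assms, of 0 a] hom_on_0[OF U assms] by (simp add: neg)
    qed (auto simp: simps intro: exI[of _ 0])
  qed (auto simp: simps)
  show "carrier ?R \<noteq> {b. \<theta> b = 0}"
  proof
    assume "carrier ?R = {b. \<theta> b = 0}"
    then have "\<theta> 1 = 0"
      by (auto simp: ring_of_type_algebra_def)
    then show False
      using hom_on_1[OF assms] by simp
  qed
  fix a b assume "a \<otimes>\<^bsub>?R\<^esub> b \<in> {b. \<theta> b = 0}"
  then show "a \<in> {b. \<theta> b = 0} \<or> b \<in> {b. \<theta> b = 0}"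
    by (auto simp: simps)
qed

text \<open>
  Replace \<open>\<theta>\<close> by its composition with a specialisation \<open>\<psi>\<close> of the last element \<open>x n\<close> to a constant \<open>c\<close>. The kernel
  grows strictly, since it now contains a preimage of \<open>x n - c\<close>, and the shorter sequence is still
  independent in the image, since \<open>\<psi>\<close> fixes it.
\<close>

lemma prime_chain_of_transcendental_sequence:
  fixes \<theta> :: "'b::comm_ring_1 \<Rightarrow> 'a::alg_closed_field"
  assumes K: "infinite K" and \<theta>: "hom_on UNIV \<theta>"
    and S: "finite S" "range \<theta> = subring_set hull (S \<union> K)"
    and x: "\<And>i. i < n \<Longrightarrow> x i \<in> range \<theta>"
      "\<And>i. i < n \<Longrightarrow> transcendental_over (subring_set hull (x ` {..<i} \<union> K)) (x i)"
  shows "\<exists>P :: nat \<Rightarrow> 'b set. (\<forall>i\<le>n. primeideal (P i) ring_of_type_algebra) \<and>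
    (\<forall>i<n. P i \<subset> P (Suc i)) \<and> P 0 = {b. \<theta> b = 0}"
  using \<theta> S x
proof (induction n arbitrary: \<theta> S)
  case 0
  then show ?case
    using primeideal_kernel by (intro exI[where x = "\<lambda>_. {b. \<theta> b = 0}"]) auto
next
  case (Suc n)
  let ?T = "subring_set hull (S \<union> K)"
  let ?F = "subring_set hull (x ` {..<n} \<union> K)"
  have U: "subring_set (UNIV :: 'b set)"
    by (simp add: subring_set_def)
  have xT: "x i \<in> ?T" if "i \<le> n" for i
    using Suc.prems(4)[of i] Suc.prems(3) that by simp
  have F: "K \<subseteq> ?F" "?F \<subseteq> ?T"
  proof -
    show "K \<subseteq> ?F"
      by (auto intro: hull_inc)
    have "K \<subseteq> ?T"
      by (auto intro: hull_inc)
    then show "?F \<subseteq> ?T"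
      using xT by (intro hull_minimal subring_set_hull) auto
  qed
  obtain \<psi> c where \<psi>: "hom_on ?T \<psi>" "\<And>y. y \<in> ?F \<Longrightarrow> \<psi> y = y" "c \<in> K" "\<psi> (x n) = c"
    using specialise_transcendental[OF K Suc.prems(2) subring_set_hull F xT[OF order_refl]] Suc.prems(5)[of n] by blast
  define \<theta>' where "\<theta>' b = \<psi> (\<theta> b)" for b
  have \<theta>': "hom_on UNIV \<theta>'"
    unfolding \<theta>'_def using \<psi>(1) Suc.prems(1,3) by (intro hom_on_comp[of ?T \<psi> UNIV \<theta>]) auto
  have "\<psi> ` K = K"
    using \<psi>(2) F by force
  then have range: "range \<theta>' = subring_set hull (\<psi> ` S \<union> K)"
    unfolding \<theta>'_def using Suc.prems(3) hom_on_image_hull[OF \<psi>(1)] by (metis image_Un image_image)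
  have xi: "x i \<in> range \<theta>'" if "i < n" for i
  proof -
    have "x i = \<psi> (x i)"
      using that by (intro \<psi>(2)[symmetric] hull_inc) auto
    moreover obtain b where "x i = \<theta> b"
      using Suc.prems(4)[of i] \<open>i < n\<close> by auto
    ultimately show ?thesis
      unfolding \<theta>'_def by (metis rangeI)
  qed
  have "finite (\<psi> ` S)"
    using Suc.prems(2) by simp
  from Suc.IH[OF \<theta>' this range xi] Suc.prems(5) obtain P :: "nat \<Rightarrow> 'b set" where
    P: "\<forall>i\<le>n. primeideal (P i) ring_of_type_algebra" "\<forall>i<n. P i \<subset> P (Suc i)" "P 0 = {b. \<theta>' b = 0}"
    by auto
  define Q where "Q i = (case i of 0 \<Rightarrow> {b. \<theta> b = 0} | Suc j \<Rightarrow> P j)" for i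
  have "{b. \<theta> b = 0} \<subset> P 0"
  proof
    have "\<psi> 0 = 0"
      by (rule hom_on_0[OF subring_set_hull \<psi>(1)])
    then show "{b. \<theta> b = 0} \<subseteq> P 0"
      by (auto simp: P(3) \<theta>'_def)
    obtain b where b: "\<theta> b = x n"
      using Suc.prems(4)[of n] by auto
    have "c \<in> ?T"
      using \<psi>(3) by (auto intro: hull_inc)
    then obtain d where d: "\<theta> d = c"
      using Suc.prems(3) by (metis imageE)
    have "\<psi> c = c"
      using \<psi>(2,3) F by auto
    then have "\<theta>' (b - d) = 0"
      using hom_on_diff[OF U \<theta>'] b d \<psi>(4) by (simp add: \<theta>'_def)
    moreover have "\<theta> (b - d) \<noteq> 0"
    proof
      assume "\<theta> (b - d) = 0"
      then have "poly [:- c, 1:] (x n) = 0"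
        using hom_on_diff[OF U Suc.prems(1)] b d by simp
      moreover have "[:- c, 1:] \<in> polys_over ?F"
        using \<psi>(3) F(1) subring_set_hull[of "x ` {..<n} \<union> K"]
        by (auto simp: pCons_in_polys_over subring_set_0 subring_set_1 subring_set_uminus subring_set_polys_over)
      ultimately show False
        using Suc.prems(5)[of n] unfolding transcendental_over_def by fastforce
    qed
    ultimately show "{b. \<theta> b = 0} \<noteq> P 0"
      by (auto simp: P(3))
  qed
  then have "\<forall>i<Suc n. Q i \<subset> Q (Suc i)" "\<forall>i\<le>Suc n. primeideal (Q i) ring_of_type_algebra"
    using P primeideal_kernel[OF Suc.prems(1)] by (auto simp: Q_def split: nat.splits)
  then show ?case
    by (intro exI[of _ Q]) (auto simp: Q_def)
qed

section \<open>Derivations and slices\<close>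

locale char0_algebra = comm_algebra scale
  for scale :: "'k::field_char_0 \<Rightarrow> 'b::idom \<Rightarrow> 'b"
begin

abbreviation cst :: "'k \<Rightarrow> 'b" where
  "cst c \<equiv> scale c 1"

lemma scale_eq_cst_mult: "scale c x = cst c * x"
  using mult_scale_left[of c 1 x] by simp

lemma cst_add: "cst (a + b) = cst a + cst b"
  and cst_diff: "cst (a - b) = cst a - cst b"
  and cst_mult: "cst (a * b) = cst a * cst b"
  by (simp_all add: scale_left_distrib scale_left_diff_distrib mult_scale_left)

lemma cst_eq_0_iff: "cst c = 0 \<longleftrightarrow> c = 0"
  by simp

lemma of_nat_cst: "of_nat n = cst (of_nat n)"
  by (induction n) (simp_all add: cst_add)

lemma of_nat_eq_0: "(of_nat n :: 'b) = 0 \<longleftrightarrow> n = 0"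
  unfolding of_nat_cst by simp

lemma base_field_cst: "cst c \<in> base_field scale"
  by (auto simp: base_field_def)

lemma subring_set_base_field: "subring_set (base_field scale)"
proof (rule subring_setI)
  show "1 \<in> base_field scale"
    using base_field_cst[of 1] by simp
qed (auto simp: base_field_def simp flip: cst_diff cst_mult)

lemma subalgebra_if_subring_set:
  assumes "subring_set T" "base_field scale \<subseteq> T"
  shows "subalgebra scale T"
  unfolding subalgebra_def subspace_def
proof (intro conjI ballI allI)
  fix c x assume "x \<in> T"
  then show "scale c x \<in> T"
    using assms base_field_cst[of c] by (subst scale_eq_cst_mult) (auto intro: subring_set_mult)
qed (use assms(1) in \<open>auto intro: subring_set_0 subring_set_1 subring_set_add subring_set_mult\<close>)

lemma derivationI:
  assumes "\<And>x y. D (x + y) = D x + D y" "\<And>x y. D (x * y) = D x * y + x * D y" "\<And>c. D (cst c) = 0"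
  shows "derivation scale D"
  unfolding derivation_def Vector_Spaces.linear_iff
proof (intro conjI allI)
  fix c x
  show "D (scale c x) = scale c (D x)"
    using assms(2)[of "cst c" x] assms(3)[of c] by (simp flip: scale_eq_cst_mult)
qed (use assms vector_space_axioms in auto)

lemma der_add: "derivation scale D \<Longrightarrow> D (x + y) = D x + D y"
  and der_scale: "derivation scale D \<Longrightarrow> D (scale c x) = scale c (D x)"
  and der_mult: "derivation scale D \<Longrightarrow> D (x * y) = D x * y + x * D y"
  by (simp_all add: derivation_def Vector_Spaces.linear_iff)

lemma der_0: "derivation scale D \<Longrightarrow> D 0 = 0"
  using der_add[of D 0 0] by (metis add_cancel_right_right add_0)

lemma der_1: "derivation scale D \<Longrightarrow> D 1 = 0"
  using der_mult[of D 1 1] by (metis add_cancel_right_right mult_1 mult_1_right)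

lemma der_diff: "derivation scale D \<Longrightarrow> D (x - y) = D x - D y"
  using der_add[of D "x - y" y] by simp

lemma der_cst: "derivation scale D \<Longrightarrow> D (cst c) = 0"
  by (simp add: der_scale der_1)

lemma der_mult_const: "derivation scale D \<Longrightarrow> D a = 0 \<Longrightarrow> D (a * x) = a * D x"
  by (simp add: der_mult)

lemma der_funpow_0: "derivation scale D \<Longrightarrow> (D ^^ n) 0 = 0"
  by (induction n) (simp_all add: der_0)

lemma der_funpow_add: "derivation scale D \<Longrightarrow> (D ^^ n) (x + y) = (D ^^ n) x + (D ^^ n) y"
  by (induction n) (simp_all add: der_add)

lemma der_funpow_diff: "derivation scale D \<Longrightarrow> (D ^^ n) (x - y) = (D ^^ n) x - (D ^^ n) y"
  by (induction n) (simp_all add: der_diff)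

lemma der_funpow_mult_const: "derivation scale D \<Longrightarrow> D a = 0 \<Longrightarrow> (D ^^ n) (a * x) = a * (D ^^ n) x"
  by (induction n) (simp_all add: der_mult_const)

lemma subring_set_kernel: "derivation scale D \<Longrightarrow> subring_set {b. D b = 0}"
  by (rule subring_setI) (simp_all add: der_1 der_diff der_mult)

lemma base_field_kernel: "derivation scale D \<Longrightarrow> base_field scale \<subseteq> {b. D b = 0}"
  by (auto simp: base_field_def der_scale der_1)

lemma der_power_Suc: "derivation scale D \<Longrightarrow> D (x ^ Suc n) = of_nat (Suc n) * x ^ n * D x"
  by (induction n) (simp_all add: der_mult algebra_simps)

lemma der_poly:
  assumes D: "derivation scale D" and p: "p \<in> polys_over {b. D b = 0}"
  shows "D (poly p x) = poly (pderiv p) x * D x"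
  using p
proof (induction p)
  case 0
  then show ?case by (simp add: der_0[OF D])
next
  case (pCons a p)
  then have "D a = 0" "p \<in> polys_over {b. D b = 0}"
    by (auto simp: pCons_in_polys_over[OF subring_set_kernel[OF D]])
  then show ?case
    using pCons.IH by (simp add: der_add[OF D] der_mult[OF D] pderiv_pCons algebra_simps)
qed

lemma pderiv_in_polys_over:
  fixes R :: "'b set"
  assumes R: "subring_set R" and p: "p \<in> polys_over R"
  shows "pderiv p \<in> polys_over R"
proof -
  have nat: "of_nat n \<in> R" for n
    by (induction n) (auto intro: subring_set_0[OF R] subring_set_1[OF R] subring_set_add[OF R])
  have "coeff p i \<in> R" for i
    using p by (simp add: polys_over_def)
  then have "coeff (pderiv p) i \<in> R" for i
    unfolding coeff_pderiv by (intro subring_set_mult[OF R] nat)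
  then show ?thesis
    by (simp add: polys_over_def)
qed

text \<open>
  If \<open>p(x) = 0\<close> with coefficients in the kernel, then \<open>p'(x) D x = 0\<close>, so \<open>p'\<close> is a relation of smaller
  degree. In characteristic zero this descent ends only with \<open>p = 0\<close>.
\<close>

lemma transcendental_over_kernel:
  assumes D: "derivation scale D" and x: "D x \<noteq> 0"
  shows "transcendental_over {b. D b = 0} x"
  unfolding transcendental_over_def
proof (intro ballI impI)
  fix p assume "p \<in> polys_over {b. D b = 0}" "poly p x = 0"
  then show "p = 0"
  proof (induction "degree p" arbitrary: p rule: less_induct)
    case less
    show ?case
    proof (cases "degree p = 0")
      case True
      then show ?thesis
        using less.prems by (auto elim: degree_eq_zeroE)
    next
      case False
      have "coeff (pderiv p) (degree p - 1) = of_nat (degree p) * lead_coeff p"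
        using False by (simp add: coeff_pderiv)
      moreover have "lead_coeff p \<noteq> 0"
        using False by auto
      ultimately have "pderiv p \<noteq> 0"
        using False by (metis coeff_0 mult_eq_0_iff of_nat_eq_0)
      moreover have "degree (pderiv p) < degree p"
      proof -
        have "degree (pderiv p) \<le> degree p - 1"
          by (intro degree_le) (auto simp: coeff_pderiv coeff_eq_0)
        with False show ?thesis by linarith
      qed
      moreover have "poly (pderiv p) x = 0"
        using der_poly[OF D less.prems(1), of x] less.prems(2) x der_0[OF D] by simp
      ultimately show ?thesis
        using less.hyps[of "pderiv p"] pderiv_in_polys_over[OF subring_set_kernel[OF D] less.prems(1)] by blast
    qed
  qed
qed

lemma der_funpow_slice_power:
  assumes D: "derivation scale D" and s: "D s = 1"
  shows "(D ^^ n) (s ^ n) = of_nat (fact n)"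
proof (induction n)
  case (Suc n)
  have "D (s ^ Suc n) = of_nat (Suc n) * s ^ n"
    by (simp only: der_power_Suc[OF D] s mult_1_right)
  moreover have "D (of_nat (Suc n)) = 0"
    using der_cst[OF D] by (simp only: of_nat_cst)
  ultimately have "(D ^^ Suc n) (s ^ Suc n) = of_nat (Suc n) * (D ^^ n) (s ^ n)"
    by (simp only: funpow_Suc_right comp_apply der_funpow_mult_const[OF D])
  then show ?case
    by (simp only: Suc.IH fact_Suc of_nat_mult of_nat_id)
qed simp

text \<open>
  The slice theorem. If \<open>D\<^sup>n a\<close> is the last nonzero iterate, subtracting \<open>(D\<^sup>n a / n!) s\<^sup>n\<close> kills it. The statement is
  relative to a subring \<open>T\<close> stable under \<open>D\<close>, because it is used both for the whole algebra and for the
  kernel of another derivation.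
\<close>

lemma slice_expansion:
  assumes D: "derivation scale D" and T: "subring_set T" "base_field scale \<subseteq> T" "\<And>x. x \<in> T \<Longrightarrow> D x \<in> T"
    and s: "s \<in> T" "D s = 1"
    and a: "a \<in> T" "(D ^^ n) a = 0"
  obtains p where "p \<in> polys_over {x \<in> T. D x = 0}" "poly p s = a"
proof -
  let ?F = "{x \<in> T. D x = 0}"
  have "subring_set ({x. D x = 0} \<inter> T)"
    using subring_set_kernel[OF D] T(1) by (auto simp: subring_set_def)
  then have F: "subring_set ?F"
    by (simp add: Int_def conj_commute)
  note P = subring_set_polys_over[OF F]
  have "\<exists>p\<in>polys_over ?F. poly p s = a"
    using a
  proof (induction n arbitrary: a)
    case 0
    then show ?case
      using subring_set_0[OF P] by (intro bexI[where x = 0]) auto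
  next
    case (Suc n)
    define c where "c = cst (1 / fact n) * (D ^^ n) a"
    have "(D ^^ m) a \<in> T" for m
      by (induction m) (use Suc.prems(1) T(3) in auto)
    then have c: "c \<in> ?F"
      using Suc.prems(2) T(2) base_field_cst[of "1 / fact n"]
      by (auto simp: c_def der_mult_const[OF D der_cst[OF D]] intro!: subring_set_mult[OF T(1)])
    have "(D ^^ n) (c * s ^ n) = cst (1 / fact n) * of_nat (fact n) * (D ^^ n) a"
      using c by (simp add: der_funpow_mult_const[OF D] der_funpow_slice_power[OF D s(2)] c_def)
    also have "cst (1 / fact n) * of_nat (fact n) = 1"
    proof -
      have "cst (1 / fact n) * of_nat (fact n) = cst (1 / fact n) * cst (fact n)"
        by (simp only: of_nat_cst of_nat_fact)
      also have "\<dots> = cst (1 / fact n * fact n)"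
        by (rule cst_mult[symmetric])
      finally show ?thesis by simp
    qed
    finally have "(D ^^ n) (a - c * s ^ n) = 0"
      by (simp add: der_funpow_diff[OF D])
    moreover have "a - c * s ^ n \<in> T"
      using c s Suc.prems by (auto intro!: subring_set_closed[OF T(1)])
    ultimately obtain p where p: "p \<in> polys_over ?F" "poly p s = a - c * s ^ n"
      using Suc.IH by blast
    then have "poly (p + monom c n) s = a"
      by (simp add: poly_monom)
    moreover have "p + monom c n \<in> polys_over ?F"
      using p c by (intro subring_set_add[OF P] monom_in_polys_over[OF F])
    ultimately show ?case
      by blast
  qed
  then show ?thesis
    using that by blast
qed

lemma LND_derivation: "D \<in> LND scale \<Longrightarrow> derivation scale D"
  and LND_nilpotent: "D \<in> LND scale \<Longrightarrow> \<exists>n. (D ^^ n) b = 0"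
  by (auto simp: LND_def)

lemma LNDI:
  assumes D: "derivation scale D" and nil: "\<And>b. \<exists>n. (D ^^ n) b = 0"
  shows "D \<in> LND scale"
  unfolding LND_def
proof (intro CollectI conjI D allI)
  fix b
  obtain n where "(D ^^ n) b = 0"
    using nil by blast
  then have "(D ^^ Suc n) b = 0"
    by (simp add: der_0[OF D])
  then show "\<exists>m\<ge>1. (D ^^ m) b = 0"
    by (intro exI[of _ "Suc n"]) auto
qed

lemma der_funpow_eq_0_mono:
  assumes "derivation scale D" "(D ^^ n) x = 0" "n \<le> m"
  shows "(D ^^ m) x = 0"
proof -
  have "(D ^^ m) x = (D ^^ (m - n)) ((D ^^ n) x)"
    using assms(3) by (metis comp_apply funpow_add le_add_diff_inverse2)
  then show ?thesis
    using assms by (simp add: der_funpow_0)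
qed

text \<open>
  The only term of the Leibniz formula for \<open>D\<^sup>m\<^sup>+\<^sup>n(x y)\<close> that survives; in characteristic zero its coefficient
  does not vanish, so nilpotency orders add up under multiplication.
\<close>

lemma Leibniz_top_term:
  assumes D: "derivation scale D"
    and "(D ^^ Suc m) x = 0" "(D ^^ Suc n) y = 0"
  shows "(D ^^ (m + n)) (x * y) = of_nat (m + n choose m) * (D ^^ m) x * (D ^^ n) y"
  using assms(2,3)
proof (induction "m + n" arbitrary: m n x y)
  case 0
  then show ?case by simp
next
  case (Suc l)
  have step: "(D ^^ (m + n)) (x * y) = (D ^^ l) (D x * y) + (D ^^ l) (x * D y)"
    unfolding Suc.hyps(2)[symmetric] by (simp add: funpow_Suc_right der_mult[OF D] der_funpow_add[OF D] del: funpow.simps)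
  show ?case
  proof (cases m)
    case 0
    then have x: "D x = 0" using Suc.prems by simp
    show ?thesis
      using der_funpow_mult_const[OF D x] 0 by simp
  next
    case m: (Suc m')
    show ?thesis
    proof (cases n)
      case 0
      then have y: "D y = 0" using Suc.prems by simp
      show ?thesis
        using der_funpow_mult_const[OF D y, of m x] 0 by (simp add: mult.commute)
    next
      case n: (Suc n')
      have "(D ^^ l) (D x * y) = of_nat (m' + n choose m') * (D ^^ m') (D x) * (D ^^ n) y"
        using Suc.hyps(1)[of m' n "D x" y] Suc.hyps(2) Suc.prems m by (simp add: funpow_swap1)
      moreover have "(D ^^ l) (x * D y) = of_nat (m + n' choose m) * (D ^^ m) x * (D ^^ n') (D y)"
        using Suc.hyps(1)[of m n' x "D y"] Suc.hyps(2) Suc.prems n by (simp add: funpow_swap1)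
      moreover have "(D ^^ m') (D x) = (D ^^ m) x" "(D ^^ n') (D y) = (D ^^ n) y"
        unfolding m n by (simp_all add: funpow_swap1)
      moreover have "m + n choose m = (m' + n choose m') + (m + n' choose m)"
        unfolding m n by simp
      ultimately show ?thesis
        using step by (simp add: algebra_simps)
    qed
  qed
qed

lemma LND_last_nonzero:
  assumes "D \<in> LND scale" "x \<noteq> 0"
  obtains n where "(D ^^ n) x \<noteq> 0" "(D ^^ Suc n) x = 0"
proof -
  obtain m where m: "(D ^^ m) x = 0" "\<And>k. k < m \<Longrightarrow> (D ^^ k) x \<noteq> 0"
    using LND_nilpotent[OF assms(1), of x] exists_least_iff[of "\<lambda>n. (D ^^ n) x = 0"] by auto
  with assms(2) obtain n where "m = Suc n"
    by (cases m) auto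
  with m that show ?thesis by auto
qed

text \<open>
  If \<open>D u = u v\<close> were nonzero, its nilpotency order would be at least that of \<open>u\<close>; but applying \<open>D\<close> lowers the
  order.
\<close>

lemma LND_eigen_zero:
  assumes D: "D \<in> LND scale" and uv: "D u = u * v"
  shows "D u = 0"
proof (rule ccontr)
  assume "D u \<noteq> 0"
  then have nz: "u \<noteq> 0" "v \<noteq> 0"
    using uv by auto
  note der = LND_derivation[OF D]
  obtain m where m: "(D ^^ m) u \<noteq> 0" "(D ^^ Suc m) u = 0"
    using LND_last_nonzero[OF D nz(1)] .
  obtain n where n: "(D ^^ n) v \<noteq> 0" "(D ^^ Suc n) v = 0"
    using LND_last_nonzero[OF D nz(2)] .
  have "(D ^^ (m + n)) (D u) = of_nat (m + n choose m) * (D ^^ m) u * (D ^^ n) v"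
    unfolding uv by (rule Leibniz_top_term[OF der m(2) n(2)])
  moreover have "\<dots> \<noteq> 0"
    using m n by (simp add: of_nat_eq_0)
  moreover have "(D ^^ (m + n)) (D u) = (D ^^ Suc (m + n)) u"
    by (simp add: funpow_swap1)
  moreover have "(D ^^ Suc (m + n)) u = 0"
    by (rule der_funpow_eq_0_mono[OF der m(2)]) simp
  ultimately show False by simp
qed

end

locale algebra_with_slice = char0_algebra scale
  for scale :: "'k::field_char_0 \<Rightarrow> 'b::idom \<Rightarrow> 'b" +
  fixes D :: "'b \<Rightarrow> 'b" and s :: 'b
  assumes D_LND: "D \<in> LND scale" and D_slice: "D s = 1"
begin

abbreviation A :: "'b set" where
  "A \<equiv> {a. D a = 0}"

lemmas D_der = LND_derivation[OF D_LND]
lemmas A_subring = subring_set_kernel[OF D_der]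
lemmas A_polys = subring_set_polys_over[OF A_subring]

lemma slice_transcendental: "transcendental_over A s"
  using transcendental_over_kernel[OF D_der, of s] D_slice by simp

lemma slice_nonzero: "s \<noteq> 0"
  using D_slice der_0[OF D_der] by auto

text \<open>
  The expansion of an element in powers of the slice, with coefficients in the kernel; it identifies the
  algebra with the polynomial ring \<open>A[s]\<close>.
\<close>

definition expand :: "'b \<Rightarrow> 'b poly" where
  "expand b = (THE p. p \<in> polys_over A \<and> poly p s = b)"

lemma expand_poly: "p \<in> polys_over A \<Longrightarrow> expand (poly p s) = p"
  unfolding expand_def
proof (rule the_equality)
  fix q assume "p \<in> polys_over A" "q \<in> polys_over A \<and> poly q s = poly p s"
  then have "q - p \<in> polys_over A" "poly (q - p) s = 0"
    by (auto intro: subring_set_diff[OF A_polys])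
  then show "q = p"
    using slice_transcendental by (auto simp: transcendental_over_def)
qed auto

lemma expand_over: "expand b \<in> polys_over A"
  and poly_expand: "poly (expand b) s = b"
proof -
  obtain n where "(D ^^ n) b = 0"
    using LND_nilpotent[OF D_LND] by blast
  then obtain p where "p \<in> polys_over {x \<in> UNIV. D x = 0}" "poly p s = b"
    using slice_expansion[OF D_der, of UNIV s b n] D_slice by (auto simp: subring_set_def)
  then show "expand b \<in> polys_over A" "poly (expand b) s = b"
    using expand_poly[of p] by auto
qed

lemma coeff_expand: "D (coeff (expand b) i) = 0"
  using expand_over[of b] by (simp add: polys_over_def)

lemma expand_eqI: "p \<in> polys_over A \<Longrightarrow> poly p s = b \<Longrightarrow> expand b = p"
  using expand_poly by blast

lemma expand_add: "expand (x + y) = expand x + expand y"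
  by (rule expand_eqI) (auto simp: poly_expand intro: subring_set_add[OF A_polys] expand_over)

lemma expand_mult: "expand (x * y) = expand x * expand y"
  by (rule expand_eqI) (auto simp: poly_expand intro: subring_set_mult[OF A_polys] expand_over)

lemma const_over: "D a = 0 \<Longrightarrow> [:a:] \<in> polys_over A"
  by (simp add: pCons_in_polys_over[OF A_subring] subring_set_0[OF A_polys])

lemma expand_const: "D a = 0 \<Longrightarrow> expand a = [:a:]"
  by (rule expand_eqI) (auto intro: const_over)

lemma expand_0: "expand 0 = 0"
  using expand_const[of 0] der_0[OF D_der] by simp

lemma expand_const_mult: "D a = 0 \<Longrightarrow> expand (a * x) = smult a (expand x)"
  by (simp add: expand_mult expand_const)

lemma expand_slice: "expand s = [:0, 1:]"
  by (rule expand_eqI)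
    (auto simp: pCons_in_polys_over[OF A_subring] der_0[OF D_der] der_1[OF D_der] subring_set_0[OF A_polys])

lemma expand_monomial: "D a = 0 \<Longrightarrow> expand (a * s ^ n) = monom a n"
  by (rule expand_eqI) (auto simp: poly_monom intro: monom_in_polys_over[OF A_subring])

lemma expand_induct [case_names const step]:
  assumes "\<And>a. D a = 0 \<Longrightarrow> Q a"
    and "\<And>a v. D a = 0 \<Longrightarrow> Q v \<Longrightarrow> Q (a + s * v)"
  shows "Q b"
proof -
  have "p \<in> polys_over A \<Longrightarrow> Q (poly p s)" for p
  proof (induction p)
    case 0
    then show ?case using assms(1)[of 0] der_0[OF D_der] by simp
  next
    case (pCons a p)
    then show ?case
      using assms(2)[of a "poly p s"] by (simp add: pCons_in_polys_over[OF A_subring])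
  qed
  from this[OF expand_over] show ?thesis
    by (simp add: poly_expand)
qed

text \<open>
  The elements \<open>a\<close> of \<open>A\<close> for which \<open>E a\<close> has degree at most \<open>m\<close> in \<open>s\<close> form a subring \<open>V\<close>. For large \<open>m\<close> it contains
  the coefficients of the finitely many generators; then the elements with coefficients in \<open>V\<close> form a
  subalgebra containing all generators.
\<close>

lemma finitely_generated_degree_bound:
  assumes S: "finite S" "subalgebra scale hull S = UNIV" and E: "derivation scale E"
  shows "\<exists>m. \<forall>a\<in>A. degree (expand (E a)) \<le> m"
proof -
  define C where "C = (\<Union>g\<in>S. set (coeffs (expand g)))"
  define m where "m = (\<Sum>c\<in>C. degree (expand (E c)))"
  define V where "V = {a\<in>A. degree (expand (E a)) \<le> m}"
  have "finite C"
    using S(1) by (simp add: C_def)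
  then have C: "degree (expand (E c)) \<le> m" if "c \<in> C" for c
    unfolding m_def using that by (intro member_le_sum) auto
  have V: "subring_set V"
  proof (rule subring_setI)
    show "1 \<in> V"
      by (simp add: V_def der_1[OF D_der] der_1[OF E] expand_0)
    fix x y assume xy: "x \<in> V" "y \<in> V"
    then have D: "D x = 0" "D y = 0" "D (- y) = 0"
      using subring_set_uminus[OF A_subring, of y] by (auto simp: V_def)
    have "expand (E (x - y)) = expand (E x) + smult (- 1) (expand (E y))"
      using der_diff[OF E] expand_add[of "E x" "- E y"] expand_const_mult[of "- 1" "E y"]
        subring_set_uminus[OF A_subring subring_set_1[OF A_subring]] by simp
    then show "x - y \<in> V"
      using xy D by (auto simp: V_def der_diff[OF D_der] intro!: degree_add_le degree_diff_le)
    have Exy: "E (x * y) = y * E x + x * E y"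
      by (simp add: der_mult[OF E] mult.commute)
    have "expand (E (x * y)) = smult y (expand (E x)) + smult x (expand (E y))"
      using D by (simp add: Exy expand_add expand_const_mult)
    then show "x * y \<in> V"
      using xy D by (auto simp: V_def der_mult[OF D_der] intro!: degree_add_le order.trans[OF degree_smult_le])
  qed
  define T where "T = {b. expand b \<in> polys_over V}"
  have "subalgebra scale T"
  proof (rule subalgebra_if_subring_set)
    note PV = subring_set_polys_over[OF V]
    have VA: "V \<subseteq> A"
      by (auto simp: V_def)
    have V_expand: "expand b \<in> polys_over V \<longleftrightarrow> (\<exists>p\<in>polys_over V. poly p s = b)" for b
      using expand_poly poly_expand[of b] polys_over_mono[OF VA] by (metis subsetD)
    show "subring_set T"
    proof (rule subring_setI)
      show "1 \<in> T"
        unfolding T_def V_expand using subring_set_1[OF PV] by (auto intro!: bexI[where x = 1])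
      fix x y assume "x \<in> T" "y \<in> T"
      then have "expand x - expand y \<in> polys_over V" "expand x * expand y \<in> polys_over V"
        by (auto simp: T_def intro: subring_set_diff[OF PV] subring_set_mult[OF PV])
      moreover have "poly (expand x - expand y) s = x - y" "poly (expand x * expand y) s = x * y"
        by (simp_all add: poly_expand)
      ultimately show "x - y \<in> T" "x * y \<in> T"
        unfolding T_def mem_Collect_eq V_expand by blast+
    qed
    show "base_field scale \<subseteq> T"
      unfolding T_def base_field_def
      by (auto simp: expand_const der_cst[OF D_der] pCons_in_polys_over[OF V] subring_set_0[OF PV])
        (simp add: V_def der_cst[OF D_der] der_cst[OF E] expand_0)
  qed
  moreover have "S \<subseteq> T"
  proof
    fix g assume g: "g \<in> S"
    have "coeff (expand g) i \<in> V" for i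
    proof (cases "coeff (expand g) i = 0")
      case True
      then show ?thesis using subring_set_0[OF V] by simp
    next
      case False
      moreover from False have "expand g \<noteq> 0"
        by auto
      ultimately have "coeff (expand g) i \<in> C"
        using g coeff_in_coeffs[of "expand g" i] le_degree[OF False] by (auto simp: C_def)
      then show ?thesis
        using C by (simp add: V_def coeff_expand)
    qed
    then show "g \<in> T"
      by (simp add: T_def polys_over_def)
  qed
  ultimately have "subalgebra scale hull S \<subseteq> T"
    by (intro hull_minimal)
  then have T: "b \<in> T" for b
    using S(2) by auto
  have "a \<in> V" if "a \<in> A" for a
    using T[of a] that by (simp add: T_def expand_const pCons_in_polys_over[OF V])
  then show ?thesis
    by (auto simp: V_def)
qed

end

section \<open>The homogeneous component of highest degree of a locally nilpotent derivation\<close>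

lemma coeff_mult_add_degree_le:
  assumes "degree p \<le> i" "degree q \<le> j"
  shows "coeff (p * q) (i + j) = coeff p i * coeff q j"
proof (cases "degree p = i \<and> degree q = j")
  case True
  then show ?thesis
    using coeff_mult_degree_sum[of p q] by simp
next
  case False
  then have "degree p < i \<or> degree q < j"
    using assms by auto
  moreover from this have "degree (p * q) < i + j"
    using assms degree_mult_le[of p q] by linarith
  ultimately show ?thesis
    by (auto simp: coeff_eq_0)
qed

text \<open>
  The assumptions say that \<open>E\<close> raises degrees in \<open>s\<close> by at most \<open>d\<close>; for \<open>E s\<close> this allows degree \<open>Suc d\<close>, as \<open>s\<close>
  has degree one.
\<close>

locale slice_and_LND = algebra_with_slice scale D s
  for scale :: "'k::field_char_0 \<Rightarrow> 'b::idom \<Rightarrow> 'b" and D s +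
  fixes E :: "'b \<Rightarrow> 'b" and d :: nat
  assumes E_LND: "E \<in> LND scale"
    and degree_E_const: "\<And>a. D a = 0 \<Longrightarrow> degree (expand (E a)) \<le> d"
    and degree_E_slice: "degree (expand (E s)) \<le> Suc d"
begin

lemmas E_der = LND_derivation[OF E_LND]

definition lead_const :: "'b \<Rightarrow> 'b" where
  "lead_const a = coeff (expand (E a)) d"

definition lead_slice :: 'b where
  "lead_slice = coeff (expand (E s)) (Suc d)"

lemma lead_const_kernel: "D (lead_const a) = 0"
  unfolding lead_const_def by (rule coeff_expand)

lemma lead_const_add: "lead_const (x + y) = lead_const x + lead_const y"
  by (simp add: lead_const_def der_add[OF E_der] expand_add)

lemma lead_const_cst: "lead_const (cst c) = 0"
  by (simp add: lead_const_def der_cst[OF E_der] expand_0)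

lemma lead_const_0: "lead_const 0 = 0"
  using lead_const_cst[of 0] by simp

lemma lead_const_mult:
  assumes "D x = 0" "D y = 0"
  shows "lead_const (x * y) = lead_const x * y + x * lead_const y"
proof -
  have "E (x * y) = y * E x + x * E y"
    by (simp add: der_mult[OF E_der] mult.commute)
  then show ?thesis
    by (simp add: lead_const_def expand_add expand_const_mult assms mult.commute)
qed

definition coeffwise :: "'b \<Rightarrow> 'b" where
  "coeffwise u = poly (map_poly lead_const (expand u)) s"

lemma coeff_map_lead_const: "coeff (map_poly lead_const p) i = lead_const (coeff p i)"
  by (rule coeff_map_poly[of lead_const, OF lead_const_0])

lemma coeffwise_derivation: "derivation scale coeffwise"
proof (rule derivationI)
  fix x y
  have "map_poly lead_const (p + q) = map_poly lead_const p + map_poly lead_const q" for p q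
    by (rule poly_eqI) (simp add: coeff_map_lead_const lead_const_add)
  then show "coeffwise (x + y) = coeffwise x + coeffwise y"
    by (simp add: coeffwise_def expand_add)
  have sum: "lead_const (sum f I) = (\<Sum>i\<in>I. lead_const (f i))" for f :: "nat \<Rightarrow> 'b" and I
    by (induction I rule: infinite_finite_induct) (simp_all add: lead_const_0 lead_const_add)
  have "map_poly lead_const (expand x * expand y) =
      map_poly lead_const (expand x) * expand y + expand x * map_poly lead_const (expand y)"
    by (rule poly_eqI)
      (simp add: coeff_mult coeff_map_lead_const sum lead_const_mult coeff_expand sum.distrib)
  then show "coeffwise (x * y) = coeffwise x * y + x * coeffwise y"
    by (simp add: coeffwise_def expand_mult poly_expand)
  show "coeffwise (cst c) = 0" for c
    by (simp add: coeffwise_def expand_const der_cst[OF D_der] map_poly_const lead_const_0 lead_const_cst)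
qed

lemma coeffwise_const: "D a = 0 \<Longrightarrow> coeffwise a = lead_const a"
  by (simp add: coeffwise_def expand_const map_poly_const lead_const_0)

lemma coeffwise_slice: "coeffwise s = 0"
  using lead_const_cst[of 1] by (simp add: coeffwise_def expand_slice map_poly_pCons lead_const_0)

text \<open>
  The homogeneous component of \<open>E\<close> of degree \<open>d\<close>: on \<open>A\<close> it is \<open>lead_const\<close> times \<open>s\<^sup>d\<close>, and it maps \<open>s\<close> to
  \<open>lead_slice * s ^ Suc d\<close>.
\<close>

definition top_part :: "'b \<Rightarrow> 'b" where
  "top_part u = s ^ d * (coeffwise u + lead_slice * s * D u)"

lemma top_part_derivation: "derivation scale top_part"
  by (rule derivationI)
    (simp_all add: top_part_def der_add[OF coeffwise_derivation] der_add[OF D_der] der_mult[OF coeffwise_derivation]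
      der_mult[OF D_der] der_cst[OF coeffwise_derivation] der_cst[OF D_der] algebra_simps)

lemma top_part_monomial:
  assumes "D c = 0"
  shows "top_part (c * s ^ n) = (lead_const c + of_nat n * lead_slice * c) * s ^ (n + d)"
proof (cases n)
  case 0
  then show ?thesis
    using assms by (simp add: top_part_def coeffwise_const)
next
  case (Suc m)
  have "coeffwise (s ^ n) = 0"
    unfolding Suc der_power_Suc[OF coeffwise_derivation] coeffwise_slice by simp
  moreover have "D (s ^ n) = of_nat n * s ^ m"
    unfolding Suc der_power_Suc[OF D_der] D_slice by simp
  ultimately show ?thesis
    using assms unfolding top_part_def
    by (simp add: der_mult[OF coeffwise_derivation] der_mult[OF D_der] coeffwise_const power_add Suc algebra_simps)
qed

text \<open>
  The coefficient here is the one in \<open>top_part_monomial\<close>: \<open>top_part\<close> computes the term of degree \<open>n + d\<close> of \<open>E u\<close> from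
  the term of degree \<open>n\<close> of \<open>u\<close>.
\<close>

lemma top_part_of_E:
  assumes "degree (expand u) \<le> n"
  shows "degree (expand (E u)) \<le> n + d"
    and "coeff (expand (E u)) (n + d) =
      lead_const (coeff (expand u) n) + of_nat n * lead_slice * coeff (expand u) n"
proof -
  define Q where "Q u n \<longleftrightarrow> degree (expand (E u)) \<le> n + d \<and>
    coeff (expand (E u)) (n + d) =
      lead_const (coeff (expand u) n) + of_nat n * lead_slice * coeff (expand u) n" for u n
  have const: "Q a n" if "D a = 0" for a n
  proof (cases n)
    case 0
    then show ?thesis
      using degree_E_const[OF that] by (simp add: Q_def expand_const[OF that] lead_const_def)
  next
    case (Suc m)
    then have "degree (expand (E a)) < n + d"
      using degree_E_const[OF that] by simp
    then show ?thesis
      using Suc by (simp add: Q_def expand_const[OF that] coeff_eq_0 lead_const_0)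
  qed
  have "\<forall>n. degree (expand u) \<le> n \<longrightarrow> Q u n"
  proof (induction u rule: expand_induct)
    case (const a)
    then show ?case
      using \<open>\<And>a n. D a = 0 \<Longrightarrow> Q a n\<close> by blast
  next
    case (step a v)
    have u: "expand (a + s * v) = pCons a (expand v)"
      by (simp add: expand_add expand_mult expand_const[OF step(1)] expand_slice)
    have "E (a + s * v) = E a + (E s * v + s * E v)"
      by (simp add: der_add[OF E_der] der_mult[OF E_der])
    then have Eu: "expand (E (a + s * v)) = expand (E a) + (expand (E s) * expand v + pCons 0 (expand (E v)))"
      by (simp add: expand_add expand_mult expand_slice)
    show ?case
    proof (intro allI impI)
      fix n assume n: "degree (expand (a + s * v)) \<le> n"
      show "Q (a + s * v) n"
      proof (cases "expand v = 0")
        case True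
        then have "v = 0"
          using poly_expand[of v] by simp
        then show ?thesis
          using \<open>\<And>a n. D a = 0 \<Longrightarrow> Q a n\<close>[OF step(1)] by simp
      next
        case False
        then obtain m where m: "n = Suc m" "degree (expand v) \<le> m"
          using n u by (cases n) auto
        note IH = step(2)[rule_format, OF m(2), unfolded Q_def]
        have a: "degree (expand (E a)) < n + d"
          using degree_E_const[OF step(1)] m by simp
        have p: "degree (expand (E s) * expand v) \<le> n + d"
          using degree_mult_le[of "expand (E s)" "expand v"] degree_E_slice m by simp
        have q: "degree (pCons 0 (expand (E v))) \<le> n + d"
          using IH m degree_pCons_le[of 0 "expand (E v)"] by simp
        \<comment> \<open>The part \<open>E s * v\<close> contributes one more copy of \<open>lead_slice\<close>; this is the step from \<open>m\<close> to \<open>n = Suc m\<close>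
          in the factor \<open>of_nat n\<close>.\<close>
        have "coeff (expand (E s) * expand v) (Suc d + m) = lead_slice * coeff (expand v) m"
          unfolding lead_slice_def by (rule coeff_mult_add_degree_le[OF degree_E_slice m(2)])
        then have "coeff (expand (E s) * expand v) (n + d) = lead_slice * coeff (expand v) m"
          using m(1) by (simp add: add.commute)
        moreover have "coeff (pCons 0 (expand (E v))) (n + d) =
            lead_const (coeff (expand v) m) + of_nat m * lead_slice * coeff (expand v) m"
          using IH m(1) by simp
        ultimately show ?thesis
          unfolding Q_def Eu using a p q m(1)
          by (auto simp: u coeff_eq_0 algebra_simps intro!: degree_add_le)
      qed
    qed
  qed
  with assms show "degree (expand (E u)) \<le> n + d"
    and "coeff (expand (E u)) (n + d) =
      lead_const (coeff (expand u) n) + of_nat n * lead_slice * coeff (expand u) n"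
    by (auto simp: Q_def)
qed

lemma top_part_funpow:
  assumes "degree (expand u) \<le> n"
  shows "degree (expand ((E ^^ j) u)) \<le> n + j * d \<and>
    (top_part ^^ j) (coeff (expand u) n * s ^ n) = coeff (expand ((E ^^ j) u)) (n + j * d) * s ^ (n + j * d)"
proof (induction j)
  case 0
  then show ?case using assms by simp
next
  case (Suc j)
  let ?v = "(E ^^ j) u" and ?N = "n + j * d"
  have "degree (expand ?v) \<le> ?N"
    using Suc.IH by blast
  note t = top_part_of_E[OF this]
  have "(top_part ^^ Suc j) (coeff (expand u) n * s ^ n) = top_part (coeff (expand ?v) ?N * s ^ ?N)"
    using Suc.IH by simp
  also have "\<dots> = coeff (expand (E ?v)) (?N + d) * s ^ (?N + d)"
    unfolding t(2) by (rule top_part_monomial[OF coeff_expand])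
  finally show ?case
    using t(1) by (simp add: algebra_simps)
qed

text \<open>
  The iterates of \<open>top_part\<close> on a monomial are terms of the iterates of \<open>E\<close>, so they vanish when the latter do.
\<close>

lemma top_part_LND: "top_part \<in> LND scale"
proof (rule LNDI[OF top_part_derivation])
  have monomial: "\<exists>j. (top_part ^^ j) (a * s ^ n) = 0" if "D a = 0" for a n
  proof -
    obtain j where j: "(E ^^ j) (a * s ^ n) = 0"
      using LND_nilpotent[OF E_LND] by blast
    have "degree (expand (a * s ^ n)) \<le> n"
      by (simp add: expand_monomial[OF that] degree_monom_le)
    from top_part_funpow[OF this, of j] show ?thesis
      using j by (auto simp: expand_monomial[OF that] expand_0)
  qed
  have sum: "\<exists>j. (top_part ^^ j) (\<Sum>i\<in>I. coeff (expand b) i * s ^ i) = 0" if "finite I" for I b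
    using that
  proof (induction I rule: finite_induct)
    case empty
    then show ?case by (auto intro: exI[of _ 0])
  next
    case (insert i I)
    then obtain j where j: "(top_part ^^ j) (\<Sum>i\<in>I. coeff (expand b) i * s ^ i) = 0"
      by blast
    obtain l where l: "(top_part ^^ l) (coeff (expand b) i * s ^ i) = 0"
      using monomial[OF coeff_expand] by blast
    note mono = der_funpow_eq_0_mono[OF top_part_derivation]
    have "(top_part ^^ max j l) (\<Sum>i\<in>insert i I. coeff (expand b) i * s ^ i) = 0"
      using insert.hyps mono[OF j, of "max j l"] mono[OF l, of "max j l"]
      by (simp add: der_funpow_add[OF top_part_derivation])
    then show ?case by blast
  qed
  show "\<exists>n. (top_part ^^ n) b = 0" for b
    using sum[of "{..degree (expand b)}" b] by (simp add: poly_expand flip: poly_altdef)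
qed

text \<open>
  The value at \<open>s\<close> is a multiple of \<open>s\<close>, which local nilpotency allows only for the value zero.
\<close>

lemma top_part_slice: "top_part s = 0"
proof -
  have "top_part s = s * (s ^ d * lead_slice)"
    by (simp add: top_part_def coeffwise_slice D_slice)
  then show ?thesis
    by (rule LND_eigen_zero[OF top_part_LND])
qed

lemma lead_slice_eq_0: "lead_slice = 0"
  using top_part_slice slice_nonzero by (simp add: top_part_def coeffwise_slice D_slice)

text \<open>
  Since \<open>top_part\<close> kills \<open>s\<close>, it is \<open>s\<^sup>d\<close> times \<open>coeffwise\<close>, and the factor \<open>s\<^sup>d\<close> is a constant for both.
\<close>

lemma coeffwise_LND: "coeffwise \<in> LND scale"
proof (rule LNDI[OF coeffwise_derivation])
  have s_pow: "coeffwise (s ^ n) = 0" for n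
    by (cases n) (simp_all only: der_power_Suc[OF coeffwise_derivation] power_0 der_1[OF coeffwise_derivation] coeffwise_slice mult_zero_right)
  have "(top_part ^^ j) b = s ^ (j * d) * (coeffwise ^^ j) b" for j b
  proof (induction j)
    case (Suc j)
    then show ?case
      by (simp add: top_part_def lead_slice_eq_0 der_mult_const[OF coeffwise_derivation s_pow] power_add)
  qed simp
  then show "\<exists>n. (coeffwise ^^ n) b = 0" for b
    using LND_nilpotent[OF top_part_LND, of b] slice_nonzero by auto
qed

end

context algebra_with_slice
begin

text \<open>
  For the least bound \<open>d\<close> the component of degree \<open>d\<close> is nonzero. Its value at \<open>s\<close> is zero, so it does not vanish on
  \<open>A\<close>. For \<open>d = 0\<close> there is no smaller bound to fail; there the element \<open>a\<close> with \<open>E a \<noteq> 0\<close> takes over.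
\<close>

lemma LND_restricting_to_kernel:
  assumes S: "finite S" "subalgebra scale hull S = UNIV"
    and E: "E \<in> LND scale" and a: "D a = 0" "E a \<noteq> 0"
  obtains \<Delta> c where "\<Delta> \<in> LND scale" "\<Delta> s = 0" "\<And>x. D x = 0 \<Longrightarrow> D (\<Delta> x) = 0" "D c = 0" "\<Delta> c \<noteq> 0"
proof -
  let ?P = "\<lambda>d. (\<forall>a\<in>A. degree (expand (E a)) \<le> d) \<and> degree (expand (E s)) \<le> Suc d"
  obtain m where "\<forall>a\<in>A. degree (expand (E a)) \<le> m"
    using finitely_generated_degree_bound[OF S LND_derivation[OF E]] by blast
  then have "?P (m + degree (expand (E s)))"
    by (auto intro: trans_le_add1)
  then obtain d where d: "?P d" "\<And>i. i < d \<Longrightarrow> \<not> ?P i"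
    using exists_least_iff[of ?P] by blast
  interpret slice_and_LND scale D s E d
    using E d(1) by unfold_locales auto
  have "\<exists>c\<in>A. lead_const c \<noteq> 0"
  proof (cases d)
    case 0
    then have "degree (expand (E a)) = 0"
      using d(1) a by auto
    then obtain e where e: "expand (E a) = [:e:]"
      by (metis degree_eq_zeroE)
    then have "E a = e"
      using poly_expand[of "E a"] by simp
    moreover have "lead_const a = e"
      unfolding lead_const_def e using 0 by simp
    ultimately show ?thesis
      using a by auto
  next
    case (Suc i)
    have "degree (expand (E s)) \<noteq> Suc d"
      using lead_slice_eq_0 unfolding lead_slice_def by (metis degree_0 leading_coeff_0_iff nat.distinct(1))
    then have "degree (expand (E s)) \<le> Suc i"
      using d(1) Suc by simp
    then obtain c where c: "c \<in> A" "\<not> degree (expand (E c)) \<le> i"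
      using d(2)[of i] Suc by auto
    then have "degree (expand (E c)) = d"
      using d(1) Suc by (auto intro: antisym)
    then have "lead_const c \<noteq> 0"
      using c(2) leading_coeff_0_iff[of "expand (E c)"] by (auto simp: lead_const_def)
    with c show ?thesis by blast
  qed
  then obtain c where "D c = 0" "lead_const c \<noteq> 0"
    by auto
  then show ?thesis
    using that[of coeffwise c] coeffwise_LND coeffwise_slice by (simp add: coeffwise_const lead_const_kernel)
qed

end

section \<open>Krull dimension and recognition of polynomial rings\<close>

context char0_algebra
begin

text \<open>
  The prime chain comes from the embedding into the algebraic closure of the field of fractions.
\<close>

lemma transcendence_degree_le_krull_dim:
  assumes S: "finite S" "subalgebra scale hull S = UNIV"
    and x: "\<And>i. i < n \<Longrightarrow> transcendental_over (subring_set hull (x ` {..<i} \<union> base_field scale)) (x i)"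
  shows "enat n \<le> krull_dim (ring_of_type_algebra :: 'b ring)"
proof -
  define \<iota> :: "'b \<Rightarrow> 'b fract alg_closure" where "\<iota> b = to_ac (to_fract b)" for b
  have \<iota>: "hom_on UNIV \<iota>" "inj \<iota>"
    by (auto simp: hom_on_def \<iota>_def inj_def)
  define K where "K = \<iota> ` base_field scale"
  have "inj cst"
    by (rule injI) (metis cst_diff cst_eq_0_iff right_minus_eq)
  then have "infinite (base_field scale)"
    unfolding base_field_def by (simp add: finite_image_iff infinite_UNIV_char_0)
  then have K: "infinite K"
    unfolding K_def using finite_image_iff[of \<iota> "base_field scale"] \<iota>(2) inj_on_subset by blast
  let ?T = "subring_set hull (S \<union> base_field scale)"
  have "subalgebra scale hull S \<subseteq> ?T"
    by (intro hull_minimal subalgebra_if_subring_set subring_set_hull) (auto intro: hull_inc)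
  then have T: "?T = UNIV"
    using S(2) by auto
  have image: "\<iota> ` (subring_set hull (Y \<union> base_field scale)) = subring_set hull (\<iota> ` Y \<union> K)" for Y
    unfolding K_def image_Un[symmetric] by (rule hom_on_image_hull) (rule hom_on_subset[OF \<iota>(1) subset_UNIV])
  have fin: "finite (\<iota> ` S)"
    using S(1) by simp
  have range: "range \<iota> = subring_set hull (\<iota> ` S \<union> K)"
    using image[of S] T by simp
  have trans: "transcendental_over (subring_set hull ((\<lambda>i. \<iota> (x i)) ` {..<i} \<union> K)) (\<iota> (x i))" if "i < n" for i
    using transcendental_over_image[OF subring_set_hull \<iota> x[OF that]] image[of "x ` {..<i}"]
    by (simp add: image_image)
  obtain P :: "nat \<Rightarrow> 'b set" where
    "\<forall>i\<le>n. primeideal (P i) ring_of_type_algebra" "\<forall>i<n. P i \<subset> P (Suc i)"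
    using prime_chain_of_transcendental_sequence[OF K \<iota>(1) fin range rangeI trans, of n] by auto
  then show ?thesis
    unfolding krull_dim_def by (intro Sup_upper) blast
qed

text \<open>
  The algebra is an image of \<open>k[X]\<close>, whose nonzero primes are maximal. In a chain \<open>P 0 \<subset> P 1 \<subset> P 2\<close>
  the preimage of \<open>P 2\<close> is generated by some \<open>g\<close>. A polynomial \<open>p = g h\<close> of least degree over \<open>P 1\<close> gives \<open>g\<close> in \<open>P 1\<close>,
  hence \<open>P 2 \<subseteq> P 1\<close>, or \<open>h\<close> in \<open>P 1\<close>, hence \<open>g\<close>
  constant by the choice of \<open>p\<close>.
\<close>

lemma krull_dim_le_one:
  assumes gen: "\<And>b. \<exists>p. poly (map_poly cst p) s = b"
  shows "krull_dim (ring_of_type_algebra :: 'b ring) \<le> 1"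
  unfolding krull_dim_def
proof (intro Sup_least)
  let ?R = "ring_of_type_algebra :: 'b ring"
  fix e assume "e \<in> {enat n |n. \<exists>P :: nat \<Rightarrow> 'b set. (\<forall>i\<le>n. primeideal (P i) ?R) \<and> (\<forall>i<n. P i \<subset> P (Suc i))}"
  then obtain n and P :: "nat \<Rightarrow> 'b set" where
    P: "e = enat n" "\<And>i. i \<le> n \<Longrightarrow> primeideal (P i) ?R" "\<And>i. i < n \<Longrightarrow> P i \<subset> P (Suc i)"
    by auto
  define ev where "ev p = poly (map_poly cst p) s" for p
  have U: "subring_set (UNIV :: 'k set)"
    by (simp add: subring_set_def)
  have "hom_on UNIV cst"
    by (simp add: hom_on_def cst_add cst_mult)
  from hom_on_eval_map_poly[OF U this, of s] have ev: "hom_on UNIV ev"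
    by (simp add: polys_over_def ev_def[abs_def])
  have mult: "ev (p * q) = ev p * ev q" for p q
    using hom_on_mult[OF ev] by simp
  have "n \<le> 1"
  proof (rule ccontr)
    assume "\<not> n \<le> 1"
    then have "primeideal (P 0) ?R" and prime: "primeideal (P 1) ?R" "primeideal (P 2) ?R"
      and strict: "P 0 \<subset> P 1" "P 1 \<subset> P 2"
      using P(2)[of 0] P(2)[of 1] P(2)[of 2] P(3)[of 0] P(3)[of 1] by (auto simp: numeral_2_eq_2)
    interpret I0: primeideal "P 0" ?R by fact
    interpret I1: primeideal "P 1" ?R by fact
    interpret I2: primeideal "P 2" ?R by fact
    have "0 \<in> P 0"
      using additive_subgroup.zero_closed[OF I0.is_additive_subgroup] by (simp add: ring_of_type_algebra_def)
    with strict(1) obtain b where "b \<in> P 1" "b \<noteq> 0"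
      by auto
    moreover obtain p0 where "ev p0 = b"
      using gen[of b] by (auto simp: ev_def)
    ultimately have "ev p0 \<in> P 1 \<and> p0 \<noteq> 0"
      by (auto simp: ev_def)
    then obtain p where p: "ev p \<in> P 1 \<and> p \<noteq> 0" "\<And>q. ev q \<in> P 1 \<and> q \<noteq> 0 \<Longrightarrow> degree p \<le> degree q"
      using ex_has_least_nat[of "\<lambda>p. ev p \<in> P 1 \<and> p \<noteq> 0" p0 degree] by blast
    then have "ev p \<in> P 2 \<and> p \<noteq> 0"
      using strict(2) by auto
    then obtain g where g: "ev g \<in> P 2 \<and> g \<noteq> 0" "\<And>q. ev q \<in> P 2 \<and> q \<noteq> 0 \<Longrightarrow> degree g \<le> degree q"
      using ex_has_least_nat[of "\<lambda>p. ev p \<in> P 2 \<and> p \<noteq> 0" p degree] by blast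
    have dvd: "g dvd q" if "ev q \<in> P 2" for q
    proof (rule ccontr)
      assume "\<not> g dvd q"
      then have nz: "q mod g \<noteq> 0"
        by (simp add: dvd_eq_mod_eq_0)
      have "ev (q mod g) = ev q - ev g * ev (q div g)"
        using hom_on_diff[OF _ ev, of q "g * (q div g)"] mult by (simp add: minus_mult_div_eq_mod subring_set_def)
      moreover have "ev g * ev (q div g) \<in> P 2"
        using I2.I_r_closed[of "ev g" "ev (q div g)"] g(1) by (simp add: ring_of_type_algebra_def)
      moreover have "x - y \<in> P 2" if "x \<in> P 2" "y \<in> P 2" for x y
      proof -
        have "- 1 * y \<in> P 2"
          using I2.I_l_closed[of y "- 1"] that by (simp add: ring_of_type_algebra_def)
        then have "x + - 1 * y \<in> P 2"
          using additive_subgroup.a_closed[OF I2.is_additive_subgroup, of x "- 1 * y"] that by (simp add: ring_of_type_algebra_def)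
        then show ?thesis by simp
      qed
      ultimately have "ev (q mod g) \<in> P 2"
        using that by simp
      then have "degree g \<le> degree (q mod g)"
        using g(2) nz by blast
      moreover have "degree (q mod g) < degree g"
        using g(1) nz degree_mod_less by blast
      ultimately show False by simp
    qed
    obtain h where h: "p = g * h"
      using dvd[of p] p(1) strict(2) by (auto elim: dvdE)
    have "ev g \<in> P 1 \<or> ev h \<in> P 1"
      using I1.I_prime[of "ev g" "ev h"] p(1) by (simp add: ring_of_type_algebra_def h mult)
    then show False
    proof
      assume g1: "ev g \<in> P 1"
      have "P 2 \<subseteq> P 1"
      proof
        fix b assume "b \<in> P 2"
        moreover obtain q where q: "b = ev q"
          using gen[of b] by (auto simp: ev_def)
        ultimately obtain r where "q = g * r"
          using dvd[of q] by (auto elim: dvdE)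
        then show "b \<in> P 1"
          using I1.I_r_closed[OF g1, of "ev r"] by (simp add: q mult ring_of_type_algebra_def)
      qed
      with strict(2) show False by auto
    next
      assume h1: "ev h \<in> P 1"
      have "h \<noteq> 0"
        using p(1) h by auto
      then have "degree p \<le> degree h"
        using h1 p(2) by blast
      then have "degree g = 0"
        using h g(1) \<open>h \<noteq> 0\<close> by (simp add: degree_mult_eq)
      then obtain c where c: "g = [:c:]" "c \<noteq> 0"
        using g(1) by (metis degree_eq_zeroE pCons_0_0)
      have "cst (1 / c) * ev g = cst (1 / c * c)"
        by (simp only: cst_mult) (simp add: ev_def c(1) map_poly_const)
      then have "1 = cst (1 / c) * ev g"
        using c(2) by simp
      moreover have "cst (1 / c) * ev g \<in> P 2"
        using I2.I_l_closed[of "ev g" "cst (1 / c)"] g(1) by (simp add: ring_of_type_algebra_def)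
      ultimately have "1 \<in> P 2"
        by simp
      then have "b \<in> P 2" for b
        using I2.I_l_closed[of 1 b] by (simp add: ring_of_type_algebra_def)
      then show False
        using I2.I_notcarr by (auto simp: ring_of_type_algebra_def)
    qed
  qed
  then show "e \<le> 1"
    using P(1) by (simp add: one_enat_def)
qed

lemma base_field_subset_makar_limanov: "base_field scale \<subseteq> makar_limanov scale"
  unfolding makar_limanov_def using base_field_kernel LND_derivation by fast

lemma makar_limanov_subset: "makar_limanov scale \<subseteq> makar_limanov_freudenburg scale"
  unfolding makar_limanov_def makar_limanov_freudenburg_def LND_star_def by auto

lemma algebraic_subset_makar_limanov:
  assumes "\<not> transcendental_over (base_field scale) f"
  shows "f \<in> makar_limanov scale"
  unfolding makar_limanov_def
proof (intro INT_I CollectI)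
  fix D assume "D \<in> LND scale"
  note D = LND_derivation[OF this]
  show "D f = 0"
  proof (rule ccontr)
    assume "D f \<noteq> 0"
    from transcendental_over_kernel[OF D this] show False
      using assms transcendental_over_antimono[OF _ base_field_kernel[OF D]] by blast
  qed
qed

lemma polys_over_base_field:
  assumes "p \<in> polys_over (base_field scale)"
  obtains q where "p = map_poly cst q"
  using polys_over_image[of cst UNIV p] assms by (auto simp: base_field_def)

lemma is_poly_ring2_if_generators:
  assumes surj: "\<And>b. \<exists>p\<in>polys_over (adjoin (base_field scale) r). poly p s = b"
    and r: "transcendental_over (base_field scale) r"
    and s: "transcendental_over (adjoin (base_field scale) r) s"
  shows "is_poly_ring2 scale"
proof -
  define g where "g q = poly (map_poly cst q) r" for q
  define f where "f P = poly (map_poly g P) s" for P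
  have U: "subring_set (UNIV :: 'k set)" "subring_set (UNIV :: 'k poly set)"
    "subring_set (UNIV :: 'k poly poly set)"
    by (simp_all add: subring_set_def)
  have "hom_on UNIV cst"
    by (simp add: hom_on_def cst_add cst_mult)
  from hom_on_eval_map_poly[OF U(1) this, of r] have g: "hom_on UNIV g"
    by (simp add: polys_over_def g_def[abs_def])
  from hom_on_eval_map_poly[OF U(2) this, of s] have f: "hom_on UNIV f"
    by (simp add: polys_over_def f_def[abs_def])
  note g0 = hom_on_0[OF U(2) g]
  have cst_over: "map_poly cst q \<in> polys_over (base_field scale)" for q
    by (auto simp: polys_over_def coeff_map_poly base_field_def)
  have range_g: "range g = adjoin (base_field scale) r"
  proof
    show "range g \<subseteq> adjoin (base_field scale) r"
      using cst_over by (auto simp: g_def adjoin_def)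
    show "adjoin (base_field scale) r \<subseteq> range g"
      by (auto simp: adjoin_def g_def elim!: polys_over_base_field)
  qed
  have g_inj: "q = 0" if "g q = 0" for q
  proof -
    have "map_poly cst q = 0"
      using r cst_over that by (auto simp: g_def transcendental_over_def)
    then show ?thesis
      by (simp add: map_poly_eq_0_iff)
  qed
  have f_inj: "P = 0" if "f P = 0" for P
  proof -
    have "map_poly g P \<in> polys_over (adjoin (base_field scale) r)"
      by (auto simp: polys_over_def coeff_map_poly g0 simp flip: range_g)
    then have "map_poly g P = 0"
      using s that by (auto simp: f_def transcendental_over_def)
    then show ?thesis
      using g_inj by (subst (asm) map_poly_eq_0_iff) (auto simp: g0)
  qed
  have "inj f"
  proof (rule injI)
    fix P Q assume "f P = f Q"
    then have "f (P - Q) = 0"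
      using hom_on_diff[OF U(3) f] by simp
    from f_inj[OF this] show "P = Q" by simp
  qed
  moreover have "surj f"
  proof
    show "UNIV \<subseteq> range f"
    proof
      fix b
      obtain p where p: "p \<in> polys_over (range g)" "poly p s = b"
        using surj[of b] range_g by auto
      then obtain P where "map_poly g P = p"
        using polys_over_image[of g UNIV p] g0 by auto
      then show "b \<in> range f"
        using p(2) by (auto simp: f_def)
    qed
  qed simp
  moreover have "f (poly2_scale c P) = scale c (f P)" for c P
  proof -
    have "poly2_scale c P = [:[:c:]:] * P"
      by (simp add: poly2_scale_def)
    moreover have "f [:[:c:]:] = cst c"
      by (simp add: f_def g_def map_poly_const g0[unfolded g_def])
    ultimately show ?thesis
      using hom_on_mult[OF f, of "[:[:c:]:]" P] scale_eq_cst_mult[of c "f P"] by simp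
  qed
  moreover have "vector_space (poly2_scale :: 'k \<Rightarrow> _)"
    by (rule comm_algebra.axioms(1)[OF comm_algebra_poly2])
  ultimately have "algebra_iso poly2_scale scale f"
    unfolding algebra_iso_def Vector_Spaces.linear_iff bij_def
    using hom_on_1[OF f] hom_on_add[OF f] hom_on_mult[OF f] vector_space_axioms by simp
  then show ?thesis
    by (auto simp: is_poly_ring2_def)
qed

end

context algebra_with_slice
begin

lemma is_poly_ring2_if_trivial_makar_limanov:
  assumes S: "finite S" "subalgebra scale hull S = UNIV"
    and dim: "krull_dim (ring_of_type_algebra :: 'b ring) = 2"
    and triv: "makar_limanov scale = base_field scale"
  shows "is_poly_ring2 scale"
proof -
  have "\<exists>E\<in>LND scale. \<exists>a. D a = 0 \<and> E a \<noteq> 0"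
  proof (rule ccontr)
    assume "\<not> ?thesis"
    then have "A \<subseteq> base_field scale"
      unfolding triv[symmetric] makar_limanov_def by auto
    then have "expand b \<in> polys_over (base_field scale)" for b
      using expand_over polys_over_mono by blast
    then have "\<exists>p. poly (map_poly cst p) s = b" for b
      using poly_expand by (metis polys_over_base_field)
    then have "krull_dim (ring_of_type_algebra :: 'b ring) \<le> 1"
      by (rule krull_dim_le_one)
    then show False
      by (simp add: dim)
  qed
  then obtain E a where "E \<in> LND scale" "D a = 0" "E a \<noteq> 0"
    by blast
  then obtain \<Delta> c where \<Delta>: "\<Delta> \<in> LND scale" "\<Delta> s = 0" "\<And>x. D x = 0 \<Longrightarrow> D (\<Delta> x) = 0" "D c = 0" "\<Delta> c \<noteq> 0"
    using LND_restricting_to_kernel[OF S] by blast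
  note \<Delta>_der = LND_derivation[OF \<Delta>(1)]
  have kernel: "f \<in> base_field scale" if f: "D f = 0" "\<Delta> f = 0" for f
  proof (rule ccontr)
    assume "f \<notin> base_field scale"
    then have f_trans: "transcendental_over (base_field scale) f"
      using algebraic_subset_makar_limanov triv by blast
    \<comment> \<open>The sequence \<open>f, c, s\<close>: each member lies outside the kernel of a derivation, \<open>\<Delta>\<close> for \<open>c\<close> and \<open>D\<close> for \<open>s\<close>, that kills
      the members before it.\<close>
    define x :: "nat \<Rightarrow> 'b" where "x i = (if i = 0 then f else if i = 1 then c else s)" for i
    have "transcendental_over (subring_set hull (x ` {..<i} \<union> base_field scale)) (x i)" if i: "i < 3" for i
    proof -
      consider "i = 0" | "i = 1" | "i = 2"
        using i by linarith
      then show ?thesis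
      proof cases
        case 1
        then show ?thesis
          using f_trans hull_same[of subring_set, OF subring_set_base_field] by (simp add: x_def)
      next
        case 2
        have "subring_set hull (x ` {..<i} \<union> base_field scale) \<subseteq> {b. \<Delta> b = 0}"
          using f base_field_kernel[OF \<Delta>_der] 2
          by (intro hull_minimal subring_set_kernel[OF \<Delta>_der]) (auto simp: x_def)
        moreover have "transcendental_over {b. \<Delta> b = 0} c"
          by (rule transcendental_over_kernel[OF \<Delta>_der \<Delta>(5)])
        ultimately show ?thesis
          using transcendental_over_antimono 2 by (simp add: x_def)
      next
        case 3
        have "subring_set hull (x ` {..<i} \<union> base_field scale) \<subseteq> A"
          using f \<Delta>(4) base_field_kernel[OF D_der] 3
          by (intro hull_minimal A_subring) (auto simp: x_def)
        then show ?thesis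
          using transcendental_over_antimono[OF slice_transcendental] 3 by (simp add: x_def)
      qed
    qed
    then have "enat 3 \<le> krull_dim (ring_of_type_algebra :: 'b ring)"
      by (rule transcendence_degree_le_krull_dim[OF S])
    then show False
      by (simp add: dim numeral_eq_enat)
  qed
  obtain n where n: "(\<Delta> ^^ n) (\<Delta> c) \<noteq> 0" "(\<Delta> ^^ Suc n) (\<Delta> c) = 0"
    using LND_last_nonzero[OF \<Delta>(1) \<Delta>(5)] .
  have iter: "D ((\<Delta> ^^ i) x) = 0" if "D x = 0" for i x
    using that by (induction i) (simp_all add: \<Delta>(3))
  have "(\<Delta> ^^ n) (\<Delta> c) \<in> base_field scale"
    using n(2) iter[OF \<Delta>(3)[OF \<Delta>(4)]] by (intro kernel) auto
  then obtain k where k: "(\<Delta> ^^ n) (\<Delta> c) = cst k"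
    by (auto simp: base_field_def)
  define r where "r = cst (1 / k) * (\<Delta> ^^ n) c"
  have "k \<noteq> 0"
    using n(1) k by auto
  have "\<Delta> ((\<Delta> ^^ n) c) = cst k"
    using k by (simp add: funpow_swap1)
  then have "\<Delta> r = cst (1 / k * k)"
    unfolding r_def by (simp only: der_mult_const[OF \<Delta>_der der_cst[OF \<Delta>_der]] cst_mult)
  then have r1: "\<Delta> r = 1"
    using \<open>k \<noteq> 0\<close> by simp
  have rA: "D r = 0"
    unfolding r_def using iter[OF \<Delta>(4)] by (simp only: der_mult_const[OF D_der der_cst[OF D_der]] mult_zero_right)
  have A: "A \<subseteq> adjoin (base_field scale) r"
  proof
    fix a assume a: "a \<in> A"
    obtain m where "(\<Delta> ^^ m) a = 0"
      using LND_nilpotent[OF \<Delta>(1)] by blast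
    then obtain p where p: "p \<in> polys_over {x \<in> A. \<Delta> x = 0}" "poly p r = a"
      using slice_expansion[OF \<Delta>_der A_subring base_field_kernel[OF D_der], of r a m] \<Delta>(3) rA r1 a by auto
    have "{x \<in> A. \<Delta> x = 0} \<subseteq> base_field scale"
      using kernel by auto
    then have "p \<in> polys_over (base_field scale)"
      using p(1) polys_over_mono by blast
    with p(2) show "a \<in> adjoin (base_field scale) r"
      by (auto simp: adjoin_def)
  qed
  have "adjoin (base_field scale) r \<subseteq> A"
    using rA by (intro adjoin_minimal A_subring base_field_kernel[OF D_der]) auto
  then have "transcendental_over (adjoin (base_field scale) r) s"
    by (rule transcendental_over_antimono[OF slice_transcendental])
  moreover have "transcendental_over (base_field scale) r"
    using transcendental_over_kernel[OF \<Delta>_der, of r] r1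
    by (intro transcendental_over_antimono[OF _ base_field_kernel[OF \<Delta>_der]]) simp
  moreover have "\<exists>p\<in>polys_over (adjoin (base_field scale) r). poly p s = b" for b
    using polys_over_mono[OF A] expand_over[of b] poly_expand[of b] by blast
  ultimately show ?thesis
    by (intro is_poly_ring2_if_generators)
qed

end

section \<open>The invariants of a polynomial ring and the equivalence\<close>

lemma algebra_iso_LND:
  assumes iso: "algebra_iso s1 s2 f" and D: "D \<in> LND s1"
  shows "(\<lambda>b. f (D (inv_into UNIV f b))) \<in> LND s2"
proof -
  let ?E = "\<lambda>b. f (D (inv_into UNIV f b))"
  have f: "vector_space s1" "vector_space s2" "f (x + y) = f x + f y" "f (s1 c x) = s2 c (f x)"
    "f (x * y) = f x * f y" "bij f" for x y c
    using iso by (auto simp: algebra_iso_def Vector_Spaces.linear_iff)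
  have f_inv: "f (inv_into UNIV f b) = b" and inv_f: "inv_into UNIV f (f a) = a" for a b
    using f(6) by (auto simp: bij_def surj_f_inv_f)
  have inv_hom: "inv_into UNIV f (x + y) = inv_into UNIV f x + inv_into UNIV f y" "inv_into UNIV f (s2 c x) = s1 c (inv_into UNIV f x)"
    "inv_into UNIV f (x * y) = inv_into UNIV f x * inv_into UNIV f y" for x y c
    using f(3)[of "inv_into UNIV f x" "inv_into UNIV f y"] f(4)[of c "inv_into UNIV f x"] f(5)[of "inv_into UNIV f x" "inv_into UNIV f y"] inv_f
    by (metis f_inv)+
  have d: "D (x + y) = D x + D y" "D (s1 c x) = s1 c (D x)" "D (x * y) = D x * y + x * D y" for x y c
    using D by (auto simp: LND_def derivation_def Vector_Spaces.linear_iff)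
  have f0: "f 0 = 0"
    using f(3)[of 0 0] by (metis add_0 add_cancel_right_right)
  have "derivation s2 ?E"
    unfolding derivation_def Vector_Spaces.linear_iff using f(2)
    by (simp add: inv_hom d f(3,4,5) f_inv)
  moreover have "(?E ^^ m) b = f ((D ^^ m) (inv_into UNIV f b))" for m b
    by (induction m) (simp_all add: f_inv inv_f)
  moreover have "\<exists>m\<ge>1. (D ^^ m) a = 0" for a
    using D by (auto simp: LND_def)
  ultimately show ?thesis
    using f0 unfolding LND_def by simp metis
qed

interpretation poly2: char0_algebra "poly2_scale :: 'k::field_char_0 \<Rightarrow> 'k poly poly \<Rightarrow> 'k poly poly"
  by (simp add: char0_algebra_def comm_algebra_poly2)

lemma funpow_pderiv_eq_0:
  fixes p :: "'a::{idom,ring_char_0} poly"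
  shows "degree p < n \<Longrightarrow> (pderiv ^^ n) p = 0"
proof (induction n arbitrary: p)
  case (Suc n)
  show ?case
  proof (cases "degree p = 0")
    case True
    then have "pderiv p = 0"
      by (simp add: pderiv_eq_0_iff)
    moreover have "(pderiv ^^ n) (0 :: 'a poly) = 0"
      by (induction n) simp_all
    ultimately show ?thesis
      by (simp add: funpow_swap1)
  next
    case False
    then show ?thesis
      using Suc by (simp add: funpow_swap1 degree_pderiv)
  qed
qed simp

lemma pderiv_outer_LND: "pderiv \<in> LND (poly2_scale :: 'k::field_char_0 \<Rightarrow> _)"
proof (rule poly2.LNDI)
  show "derivation (poly2_scale :: 'k \<Rightarrow> _) pderiv"
    by (rule poly2.derivationI)
      (simp_all add: pderiv_add pderiv_mult poly2_scale_def pderiv_smult mult.commute)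
  show "\<exists>n. (pderiv ^^ n) P = 0" for P :: "'k poly poly"
    using funpow_pderiv_eq_0[of P "Suc (degree P)"] by blast
qed

lemma pderiv_inner_LND: "map_poly pderiv \<in> LND (poly2_scale :: 'k::field_char_0 \<Rightarrow> _)"
proof (rule poly2.LNDI)
  have c: "coeff (map_poly pderiv P) i = pderiv (coeff P i)" for P :: "'k poly poly" and i
    by (simp add: coeff_map_poly)
  have prod: "pderiv (p * q) = pderiv p * q + p * pderiv q" for p q :: "'k poly"
    by (simp add: pderiv_mult mult.commute add.commute)
  have sum: "pderiv (sum f I) = (\<Sum>i\<in>I. pderiv (f i))" for f :: "nat \<Rightarrow> 'k poly" and I
    by (induction I rule: infinite_finite_induct) (simp_all add: pderiv_add)
  show "derivation (poly2_scale :: 'k \<Rightarrow> _) (map_poly pderiv)"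
  proof (rule poly2.derivationI)
    fix P Q :: "'k poly poly"
    show "map_poly pderiv (P + Q) = map_poly pderiv P + map_poly pderiv Q"
      by (rule poly_eqI) (simp add: c pderiv_add)
    show "map_poly pderiv (P * Q) = map_poly pderiv P * Q + P * map_poly pderiv Q"
      by (rule poly_eqI) (simp add: c coeff_mult sum prod sum.distrib)
    show "map_poly pderiv (poly2_scale a 1) = 0" for a :: 'k
      by (rule poly_eqI) (simp add: c poly2_scale_def one_pCons coeff_pCons split: nat.splits)
  qed
  fix P :: "'k poly poly"
  define m where "m = Suc (\<Sum>i\<le>degree P. degree (coeff P i))"
  have deg: "degree (coeff P i) < m" for i
  proof (cases "i \<le> degree P")
    case True
    then have "degree (coeff P i) \<le> (\<Sum>i\<le>degree P. degree (coeff P i))"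
      by (intro member_le_sum) auto
    then show ?thesis by (simp add: m_def)
  qed (simp add: m_def coeff_eq_0)
  have "coeff ((map_poly pderiv ^^ n) P) i = (pderiv ^^ n) (coeff P i)" for n i
    by (induction n) (simp_all add: c)
  then have "(map_poly pderiv ^^ m) P = 0"
    using funpow_pderiv_eq_0[OF deg] by (intro poly_eqI) simp
  then show "\<exists>n. (map_poly pderiv ^^ n) P = 0" by blast
qed

text \<open>
  Both partial derivatives have a slice, namely the respective variable, and a polynomial killed by both is
  constant.
\<close>

lemma makar_limanov_freudenburg_poly_ring:
  fixes scale :: "'k::field_char_0 \<Rightarrow> 'b::idom \<Rightarrow> 'b"
  assumes "char0_algebra scale" "is_poly_ring2 scale"
  shows "makar_limanov_freudenburg scale = base_field scale"
proof
  interpret char0_algebra scale by fact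
  show "base_field scale \<subseteq> makar_limanov_freudenburg scale"
    using base_field_subset_makar_limanov makar_limanov_subset by blast
  obtain f where iso: "algebra_iso poly2_scale scale f"
    using assms(2) by (auto simp: is_poly_ring2_def)
  have f: "f 1 = 1" "bij f" "f (x + y) = f x + f y" "f (poly2_scale c x) = scale c (f x)" for x y c
    using iso by (auto simp: algebra_iso_def Vector_Spaces.linear_iff)
  have f_inv: "f (inv_into UNIV f b) = b" and inv_f: "inv_into UNIV f (f a) = a" for a b
    using f(2) by (auto simp: bij_def surj_f_inv_f)
  have f0: "f 0 = 0"
    using f(3)[of 0 0] by (metis add_0 add_cancel_right_right)
  let ?D1 = "\<lambda>b. f (pderiv (inv_into UNIV f b))" and ?D2 = "\<lambda>b. f (map_poly pderiv (inv_into UNIV f b))"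
  have "?D1 (f [:0, 1:]) = 1" "?D2 (f [:[:0, 1:]:]) = 1"
    by (simp_all add: inv_f pderiv_pCons map_poly_const f(1) flip: one_pCons)
  then have star: "?D1 \<in> LND_star scale" "?D2 \<in> LND_star scale"
    using algebra_iso_LND[OF iso pderiv_outer_LND] algebra_iso_LND[OF iso pderiv_inner_LND]
    by (auto simp: LND_star_def)
  show "makar_limanov_freudenburg scale \<subseteq> base_field scale"
  proof
    fix b assume "b \<in> makar_limanov_freudenburg scale"
    then have "?D1 b = 0" "?D2 b = 0"
      using star unfolding makar_limanov_freudenburg_def by blast+
    then have "pderiv (inv_into UNIV f b) = 0" "map_poly pderiv (inv_into UNIV f b) = 0"
      using f0 inv_f by metis+
    then obtain q where q: "inv_into UNIV f b = [:q:]" "pderiv q = 0"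
      by (auto simp: pderiv_eq_0_iff map_poly_const elim!: degree_eq_zeroE)
    then obtain c where "q = [:c:]"
      by (auto simp: pderiv_eq_0_iff elim!: degree_eq_zeroE)
    then have "inv_into UNIV f b = poly2_scale c 1"
      using q by (simp add: poly2_scale_def one_pCons)
    then have "b = scale c 1"
      using f_inv[of b] f(1,4) by simp
    then show "b \<in> base_field scale"
      by (simp add: base_field_cst)
  qed
qed

theorem theorem3p8:
  fixes scale :: "'k::field_char_0 \<Rightarrow> 'b::idom \<Rightarrow> 'b"
  assumes "affine_domain scale"
    and "krull_dim (ring_of_type_algebra :: 'b ring) = 2"
  shows "(is_poly_ring2 scale \<longleftrightarrow> makar_limanov_freudenburg scale = base_field scale) \<and>
         (makar_limanov_freudenburg scale = base_field scale \<longleftrightarrow>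
            makar_limanov scale = base_field scale \<and> makar_limanov_freudenburg scale \<noteq> UNIV)"
proof -
  interpret affine_domain scale by fact
  interpret char0_algebra scale ..
  obtain S where S: "finite S" "subalgebra scale hull S = UNIV"
    using finitely_generated by blast
  have "base_field scale \<noteq> UNIV"
  proof
    assume univ: "base_field scale = UNIV"
    have "\<exists>p. poly (map_poly cst p) 0 = b" for b
    proof -
      obtain c where "b = cst c"
        using univ by (auto simp: base_field_def)
      then show ?thesis
        by (intro exI[of _ "[:c:]"]) (simp add: map_poly_const)
    qed
    then have "krull_dim (ring_of_type_algebra :: 'b ring) \<le> 1"
      by (rule krull_dim_le_one)
    then show False
      by (simp add: assms(2))
  qed
  then have II_III: "makar_limanov scale = base_field scale \<and> makar_limanov_freudenburg scale \<noteq> UNIV"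
    if "makar_limanov_freudenburg scale = base_field scale"
    using that base_field_subset_makar_limanov makar_limanov_subset by auto
  have III_I: "is_poly_ring2 scale"
    if triv: "makar_limanov scale = base_field scale" and nonempty: "makar_limanov_freudenburg scale \<noteq> UNIV"
  proof -
    obtain D s where "D \<in> LND scale" "D s = 1"
      using nonempty by (auto simp: makar_limanov_freudenburg_def LND_star_def)
    then interpret algebra_with_slice scale D s
      by unfold_locales
    show ?thesis
      by (rule is_poly_ring2_if_trivial_makar_limanov[OF S assms(2) triv])
  qed
  have I_II: "makar_limanov_freudenburg scale = base_field scale" if "is_poly_ring2 scale"
    by (rule makar_limanov_freudenburg_poly_ring[OF char0_algebra_axioms that])
  show ?thesis
    using I_II II_III III_I by blast
qed

end
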